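(* There exists a family of total Boolean functions $f$ (one for each input length in an infinite sequence of input lengths) such that $\mathrm{H}_1(f) = \widetilde{\mathcal{O}}(\mathrm{R}(f)^{4/5})$.
   Context: For a (possibly partial) Boolean function $f:D\to\{0,1\}$ with $D\subseteq\{0,1\}^n$, $\mathrm{R}(f)$ denotes its bounded-error (error $1/3$) classical randomized query complexity. A quantum decision tree making $t$ queries is specified by unitaries $U_0,\dots,U_t$ and outputs the result of measuring $U_tO_xU_{t-1}O_x\cdots O_xU_0|0\rangle|0\rangle|0\rangle$ in the computational basis, where $O_x|i\rangle|b\rangle|w\rangle=|i\rangle|b\oplus x_i\rangle|w\rangle$. A hybrid decision tree $T$ is a rooted tree where each internal node $v$ carries a quantum decision tree $\mathcal{A}_v$, whose possible outputs are in one-to-one correspondence with the children of $v$; leaves are labeled with output values. On input $x$, starting from the root one runs $\mathcal{A}_v(x)$, moves to the child corresponding to its output, and repeats until reaching a leaf, whose label is the output. The cost of a root-to-leaf path is the sum of the query counts of the $\mathcal{A}_v$ on it, and the cost of $T$ is the maximum cost of a root-to-leaf path. $T$ is $q$-limited if every $\mathcal{A}_v$ makes at most $q$ queries. $T$ computes $f$ if for every $x\in D$ it outputs $f(x)$ with probability at least $2/3$. The hybrid query complexity $\mathrm{H}_q(f)$ is the minimal cost of a $q$-limited hybrid decision tree computing $f$. $\widetilde{\mathcal{O}}(g)$ means $\mathcal{O}(g\,\mathrm{polylog}\, g)$. *)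

theory Defs
  imports
    "HOL-Probability.Probability_Mass_Function"
    "HOL-Library.Landau_Symbols"
    "Jordan_Normal_Form.Schur_Decomposition"
begin

no_notation Finite_Cartesian_Product.vec_nth (infixl "$" 90)

text \<open>
  Elements of the Boolean cube of dimension \<open>n\<close> are the Boolean lists of length \<open>n\<close>, with
  coordinates numbered from \<open>0\<close>. A partial Boolean function is given by \<open>n\<close>, a domain
  \<open>D \<subseteq> bool_cube n\<close> and a function \<open>f\<close> whose values outside \<open>D\<close> are ignored;
  it is total if \<open>D = bool_cube n\<close>.
\<close>

definition bool_cube :: "nat \<Rightarrow> bool list set"
  where "bool_cube n = {x. length x = n}"


section \<open>Randomized query complexity\<close>

datatype dtree = Output bool | Query nat dtree dtree

fun valid_dtree :: "nat \<Rightarrow> dtree \<Rightarrow> bool" where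
  "valid_dtree n (Output b) \<longleftrightarrow> True"
| "valid_dtree n (Query i l r) \<longleftrightarrow> i < n \<and> valid_dtree n l \<and> valid_dtree n r"

fun dtree_depth :: "dtree \<Rightarrow> nat" where
  "dtree_depth (Output b) = 0"
| "dtree_depth (Query i l r) = Suc (max (dtree_depth l) (dtree_depth r))"

fun dtree_eval :: "dtree \<Rightarrow> bool list \<Rightarrow> bool" where
  "dtree_eval (Output b) x = b"
| "dtree_eval (Query i l r) x = (if x ! i then dtree_eval r x else dtree_eval l x)"

text \<open>
  A randomized decision tree is a probability distribution over deterministic decision trees;
  its cost is the worst case number of queries.
\<close>

definition R_query :: "nat \<Rightarrow> bool list set \<Rightarrow> (bool list \<Rightarrow> bool) \<Rightarrow> nat" where
  "R_query n D f = (LEAST k. \<exists>P :: dtree pmf.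
     (\<forall>t \<in> set_pmf P. valid_dtree n t \<and> dtree_depth t \<le> k) \<and>
     (\<forall>x \<in> D. measure_pmf.prob P {t. dtree_eval t x = f x} \<ge> 2 / 3))"


section \<open>Quantum decision trees\<close>

definition is_unitary :: "nat \<Rightarrow> complex mat \<Rightarrow> bool" where
  "is_unitary d U \<longleftrightarrow> U \<in> carrier_mat d d \<and> mat_adjoint U * U = 1\<^sub>m d \<and> U * mat_adjoint U = 1\<^sub>m d"

text \<open>
  \<open>QDT t W U\<close> makes \<open>t\<close> queries, has a work register with \<open>W\<close> basis states, and applies the
  unitaries \<open>U 0, \<dots>, U t\<close>. The basis state with index register \<open>i < n\<close>, answer bit \<open>b\<close> and
  work register \<open>w < W\<close> is the unit vector with position \<open>basis_pos W i b w\<close>.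
\<close>

datatype qdt = QDT (num_queries: nat) (work_dim: nat) (gate: "nat \<Rightarrow> complex mat")

definition qdt_dim :: "nat \<Rightarrow> qdt \<Rightarrow> nat"
  where "qdt_dim n A = n * 2 * work_dim A"

definition basis_pos :: "nat \<Rightarrow> nat \<Rightarrow> bool \<Rightarrow> nat \<Rightarrow> nat"
  where "basis_pos W i b w = (i * 2 + of_bool b) * W + w"

definition valid_qdt :: "nat \<Rightarrow> qdt \<Rightarrow> bool" where
  "valid_qdt n A \<longleftrightarrow> work_dim A > 0 \<and> (\<forall>j \<le> num_queries A. is_unitary (qdt_dim n A) (gate A j))"

text \<open>
  In the exclusive or of the answer bit with the queried input bit, disequality of Booleans
  is addition modulo two.
\<close>

definition query_op :: "nat \<Rightarrow> nat \<Rightarrow> bool list \<Rightarrow> complex mat" where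
  "query_op n W x = mat (n * 2 * W) (n * 2 * W) (\<lambda>(r, c).
     of_bool (\<exists>i < n. \<exists>b. \<exists>w < W. c = basis_pos W i b w \<and> r = basis_pos W i (b \<noteq> x ! i) w))"

fun qdt_state :: "nat \<Rightarrow> qdt \<Rightarrow> bool list \<Rightarrow> nat \<Rightarrow> complex vec" where
  "qdt_state n A x 0 = gate A 0 *\<^sub>v unit_vec (qdt_dim n A) (basis_pos (work_dim A) 0 False 0)"
| "qdt_state n A x (Suc j) =
     gate A (Suc j) *\<^sub>v (query_op n (work_dim A) x *\<^sub>v qdt_state n A x j)"

definition qdt_prob :: "nat \<Rightarrow> qdt \<Rightarrow> bool list \<Rightarrow> nat \<Rightarrow> real" where
  "qdt_prob n A x r = (cmod (qdt_state n A x (num_queries A) $ r))\<^sup>2"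

lemma basis_pos_less:
  assumes "i < n" "w < W"
  shows "basis_pos W i b w < n * 2 * W"
proof -
  have "(i * 2 + of_bool b) * W + w < (i * 2 + of_bool b + 1) * W"
    using assms by simp
  also have "\<dots> \<le> n * 2 * W"
    using assms by (intro mult_right_mono) auto
  finally show ?thesis by (simp add: basis_pos_def)
qed

lemma basis_pos_inject:
  assumes "w < W" "w' < W"
  shows "basis_pos W i b w = basis_pos W i' b' w' \<longleftrightarrow> i = i' \<and> b = b' \<and> w = w'"
proof
  assume eq: "basis_pos W i b w = basis_pos W i' b' w'"
  have "w = basis_pos W i b w mod W" "w' = basis_pos W i' b' w' mod W"
    using assms by (auto simp: basis_pos_def)
  moreover have "i * 2 + of_bool b = basis_pos W i b w div W"
    "i' * 2 + of_bool b' = basis_pos W i' b' w' div W"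
    using assms by (auto simp: basis_pos_def)
  ultimately have "w = w'" and e: "i * 2 + of_bool b = i' * 2 + (of_bool b' :: nat)"
    using eq by simp_all
  moreover from e have "i = i' \<and> b = b'"
    by (cases b; cases b') (auto, presburger+)
  ultimately show "i = i' \<and> b = b' \<and> w = w'" by simp
qed simp

lemma query_op_basis:
  assumes "i < n" "w < W"
  shows "query_op n W x *\<^sub>v unit_vec (n * 2 * W) (basis_pos W i b w) =
    unit_vec (n * 2 * W) (basis_pos W i (b \<noteq> x ! i) w)"
proof (rule eq_vecI)
  fix r assume "r < dim_vec (unit_vec (n * 2 * W) (basis_pos W i (b \<noteq> x ! i) w) :: complex vec)"
  then have r: "r < n * 2 * W" by simp
  have "(query_op n W x *\<^sub>v unit_vec (n * 2 * W) (basis_pos W i b w)) $ r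
      = query_op n W x $$ (r, basis_pos W i b w)"
    using r basis_pos_less[OF assms, of b]
    by (simp add: query_op_def)
  also have "\<dots> = of_bool (r = basis_pos W i (b \<noteq> x ! i) w)"
    using r assms basis_pos_less[OF assms, of b]
    by (auto simp: query_op_def basis_pos_inject)
  finally show "(query_op n W x *\<^sub>v unit_vec (n * 2 * W) (basis_pos W i b w)) $ r =
      unit_vec (n * 2 * W) (basis_pos W i (b \<noteq> x ! i) w) $ r"
    using r basis_pos_less[OF assms, of "b \<noteq> x ! i"] by simp
qed (simp add: query_op_def)


section \<open>Hybrid decision trees\<close>

text \<open>
  The children of an internal node are listed in the order of the computational basis states,
  which are the possible measurement outcomes.
\<close>

datatype hdt = Leaf bool | Node qdt "hdt list"

fun valid_hdt :: "nat \<Rightarrow> hdt \<Rightarrow> bool" where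
  "valid_hdt n (Leaf b) \<longleftrightarrow> True"
| "valid_hdt n (Node A ts) \<longleftrightarrow>
     valid_qdt n A \<and> length ts = qdt_dim n A \<and> (\<forall>t \<in> set ts. valid_hdt n t)"

fun q_limited :: "nat \<Rightarrow> hdt \<Rightarrow> bool" where
  "q_limited q (Leaf b) \<longleftrightarrow> True"
| "q_limited q (Node A ts) \<longleftrightarrow> num_queries A \<le> q \<and> (\<forall>t \<in> set ts. q_limited q t)"

fun path_costs :: "hdt \<Rightarrow> nat set" where
  "path_costs (Leaf b) = {0}"
| "path_costs (Node A ts) = (\<lambda>c. num_queries A + c) ` (\<Union>t \<in> set ts. path_costs t)"

definition hdt_cost :: "hdt \<Rightarrow> nat"
  where "hdt_cost T = Max (path_costs T)"

lemma size_nth_hdt [termination_simp]: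
  "i < length ts \<Longrightarrow> size (ts ! i) < Suc (size_list size (ts :: hdt list))"
  using size_list_estimation'[of "ts ! i" ts "size (ts ! i)" size] by simp

text \<open>The probability that the tree outputs \<open>y\<close> on input \<open>x\<close>.\<close>

fun hdt_prob :: "nat \<Rightarrow> hdt \<Rightarrow> bool list \<Rightarrow> bool \<Rightarrow> real" where
  "hdt_prob n (Leaf b) x y = of_bool (b = y)"
| "hdt_prob n (Node A ts) x y = (\<Sum>r < length ts. qdt_prob n A x r * hdt_prob n (ts ! r) x y)"

definition hdt_computes :: "nat \<Rightarrow> hdt \<Rightarrow> bool list set \<Rightarrow> (bool list \<Rightarrow> bool) \<Rightarrow> bool" where
  "hdt_computes n T D f \<longleftrightarrow> (\<forall>x \<in> D. hdt_prob n T x (f x) \<ge> 2 / 3)"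

definition H_query :: "nat \<Rightarrow> nat \<Rightarrow> bool list set \<Rightarrow> (bool list \<Rightarrow> bool) \<Rightarrow> nat" where
  "H_query q n D f = (LEAST c. \<exists>T.
     valid_hdt n T \<and> q_limited q T \<and> hdt_computes n T D f \<and> hdt_cost T = c)"


section \<open>Asymptotics\<close>

text \<open>
  \<open>O(g polylog g)\<close>, meant for \<open>g\<close> tending to infinity: a polynomial in \<open>ln g\<close> is then bounded,
  up to a constant factor, by a power of \<open>ln g\<close>.
\<close>

definition soft_bigo :: "(nat \<Rightarrow> real) \<Rightarrow> (nat \<Rightarrow> real) set" where
  "soft_bigo g = (\<Union>c :: nat. O(\<lambda>k. g k * ln (g k) ^ c))"

end

theory Submission
  imports Defs "HOL-Probability.Product_PMF" "HOL-Real_Asymp.Real_Asymp"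
begin

text \<open>
  The base problem is a Boolean version of Simon's problem: is a bit string \<open>f\<close> of length \<open>n = 4 ^ u\<close>
  periodic, \<open>f y = f (y XOR s)\<close> for some \<open>s \<noteq> 0\<close>, or far from every such period? Fourier sampling
  with one query per sample returns characters that are trivial on every period, so \<open>O(u)\<close> separate
  one-query circuits decide this with error exponentially small in \<open>u\<close>. A classical algorithm learns
  nothing before it has queried two points at distance \<open>s\<close>, which takes about \<open>\<surd>n\<close> queries.

  Composing an \<open>n\<close> by \<open>n\<close> AND-OR tree with this problem gives hybrid cost about \<open>n ^ 2\<close>, randomized
  cost about \<open>n ^ 2 \<surd>n\<close>, and certificates for either value that consist of \<open>n\<close> cells, that is, \<open>n ^ 2\<close>
  bits. The promise is removed by a cheat sheet: \<open>c = 6 u\<close> independent copies address one of \<open>2 ^ c\<close> pages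
  and the function is true iff the addressed page holds valid certificates. Hence \<open>H \<approx> n ^ 2\<close> and
  \<open>R \<approx> n ^ (5 / 2)\<close> up to powers of \<open>u\<close>.

  For the lower bound every row of every block hides one periodic cell, and one row of a block is
  made random to switch the block from 1 to 0. A tree notices this only through a collision in the hidden cell
  of that row, so on an input with blank pages it behaves as if all blocks were 1; it therefore
  reads the page addressed by a random \<open>b\<close> with small probability and cannot tell a blank page
  from a valid one.
\<close>

text \<open>With one output bit per point, equal values at two points do not reveal a period, so the
  negative instances of the Boolean Simon problem are random strings, far from every period instead
  of injective. Indistinguishability is exact counting: an input is a uniform set \<open>G\<close>
  read through a map \<open>rep\<close> that identifies \<open>y\<close> with \<open>y XOR s\<close>
  in the hidden cells, and the number of sets \<open>G\<close> that follow a given path depends only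
  on which queried coordinates are identified. A planted row is therefore invisible until two
  queried points differ by its period. The obstacle is an adaptive tree that spreads its queries
  unevenly. Inside a cell, k points have at most min(k*k, n) differences, hence at most k times sqrt
  n; this linear bound adds up over the cells of a row, so a row withstands about n sqrt n queries.
  Uneven attention to the rows is handled by cutting the tree off at a budget \<open>m\<close> per
  row. The random choice of the switched row gains the last factor n. The number of pages only has
  to exceed the depth of the tree, about 32^u, by an exponential factor, which is why
  \<open>c = 6 u\<close>.\<close>

unbundle bit_operations_syntax

section \<open>Walsh characters\<close>

lemma xor_less_two_power:
  fixes x y :: nat
  assumes "x < 2 ^ K" "y < 2 ^ K"
  shows "x XOR y < 2 ^ K"
  using assms by (metis take_bit_nat_eq_self_iff take_bit_xor)

lemma xor_left_self [simp]: "x XOR (x XOR y) = (y :: nat)"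
  by (simp flip: xor.assoc)

lemma xor_right_self [simp]: "(x XOR y) XOR y = (x :: nat)"
  by (simp add: xor.assoc)

lemma xor_eq_0_iff_nat: "x XOR y = 0 \<longleftrightarrow> x = (y :: nat)"
  by (metis xor_left_self xor_self_eq xor.right_neutral)

lemma xor_div_2: "(x XOR y) div 2 = (x div 2) XOR (y div 2 :: nat)"
  by (subst xor_rec) simp

lemma bij_betw_xor:
  fixes y :: nat
  assumes "y < 2 ^ K"
  shows "bij_betw (\<lambda>x. x XOR y) {..<2 ^ K} {..<2 ^ K}"
  by (rule bij_betwI[where g = "\<lambda>x. x XOR y"]) (use assms xor_less_two_power in auto)

lemma sum_xor:
  fixes y :: nat
  assumes "y < 2 ^ K"
  shows "(\<Sum>x<2 ^ K. g (x XOR y)) = (\<Sum>x<2 ^ K. g x)"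
  using sum.reindex_bij_betw[OF bij_betw_xor[OF assms], of g] by simp

definition walsh :: "nat \<Rightarrow> nat \<Rightarrow> nat \<Rightarrow> real" where
  "walsh K z x = (\<Prod>j<K. if bit z j \<and> bit x j then -1 else 1)"

lemma walsh_commute: "walsh K z x = walsh K x z"
  by (simp add: walsh_def conj_commute)

lemma walsh_xor_right: "walsh K z (x XOR y) = walsh K z x * walsh K z y"
  unfolding walsh_def prod.distrib[symmetric]
  by (rule prod.cong) (auto simp: bit_xor_iff)

lemma walsh_xor_left: "walsh K (x XOR y) z = walsh K x z * walsh K y z"
  by (metis walsh_commute walsh_xor_right)

lemma walsh_0 [simp]: "walsh K 0 x = 1" "walsh K x 0 = 1"
  by (simp_all add: walsh_def)

lemma walsh_cases: "walsh K z x = 1 \<or> walsh K z x = -1"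
  unfolding walsh_def by (induction K) auto

lemma bit_less_two_power:
  fixes z :: nat
  assumes "z < 2 ^ K" "bit z j"
  shows "j < K"
  using assms by (metis bit_take_bit_iff take_bit_nat_eq_self_iff)

lemma sum_walsh:
  assumes "z < 2 ^ K"
  shows "(\<Sum>x<2 ^ K. walsh K z x) = (if z = 0 then 2 ^ K else 0)"
proof (cases "z = 0")
  case False
  then obtain j where j: "bit z j"
    using bit_eq_iff[of z 0] by auto
  then have jK: "j < K" using bit_less_two_power assms by blast
  have "walsh K z (2 ^ j) = (\<Prod>i<K. if i = j then -1 else 1)"
    unfolding walsh_def by (rule prod.cong) (auto simp: bit_exp_iff j)
  also have "\<dots> = -1" using jK by simp
  finally have w: "walsh K z (2 ^ j) = -1" .
  have "(\<Sum>x<2 ^ K. walsh K z x) = (\<Sum>x<2 ^ K. walsh K z (x XOR 2 ^ j))"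
    using jK by (intro sum_xor[symmetric]) simp
  also have "\<dots> = - (\<Sum>x<2 ^ K. walsh K z x)"
    by (simp add: walsh_xor_right w sum_negf)
  finally show ?thesis using False by simp
qed simp

lemma walsh_orthogonal:
  assumes "z < 2 ^ K" "z' < 2 ^ K"
  shows "(\<Sum>x<2 ^ K. walsh K z x * walsh K z' x) = (if z = z' then 2 ^ K else 0)"
  using sum_walsh[OF xor_less_two_power[OF assms]]
  by (simp add: walsh_xor_left xor_eq_0_iff_nat)

text \<open>The squared Walsh-Fourier coefficient of the sign function of \<open>F\<close> at
  \<open>v\<close>, which is the probability that Fourier sampling returns \<open>v\<close>.\<close>

definition walsh_weight :: "nat \<Rightarrow> (nat \<Rightarrow> bool) \<Rightarrow> nat \<Rightarrow> real" where
  "walsh_weight K F v = ((\<Sum>z<2 ^ K. walsh K v z * (if F z then -1 else 1)) / 2 ^ K)\<^sup>2"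

lemma walsh_weight_nonneg: "walsh_weight K F v \<ge> 0"
  by (simp add: walsh_weight_def)

text \<open>The transform of the power spectrum is the autocorrelation: after the square is
  expanded, orthogonality keeps only the terms with \<open>z' = z XOR t\<close>. The case
  \<open>t = 0\<close> is Parseval's identity.\<close>

lemma sum_walsh_weight:
  assumes t: "t < 2 ^ K"
  shows "(\<Sum>v<2 ^ K. walsh_weight K F v * walsh K v t) =
    (\<Sum>z<2 ^ K. if F z = F (z XOR t) then 1 else -1) / 2 ^ K"
proof -
  define S where "S z = (if F z then -1 else 1 :: real)" for z
  define M where "M = (2 ^ K :: real)"
  have M: "M > 0" by (simp add: M_def)
  have "(\<Sum>v<2 ^ K. walsh_weight K F v * walsh K v t)
      = (\<Sum>v<2 ^ K. \<Sum>z<2 ^ K. \<Sum>z'<2 ^ K. S z * S z' * (walsh K v (z XOR t) * walsh K v z')) / M\<^sup>2"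
    by (simp add: walsh_weight_def S_def[symmetric] M_def[symmetric] power2_eq_square sum_product
        sum_distrib_left sum_distrib_right walsh_xor_right sum_divide_distrib ac_simps)
  also have "(\<Sum>v<2 ^ K. \<Sum>z<2 ^ K. \<Sum>z'<2 ^ K. S z * S z' * (walsh K v (z XOR t) * walsh K v z'))
      = (\<Sum>z<2 ^ K. \<Sum>z'<2 ^ K. S z * S z' * (\<Sum>v<2 ^ K. walsh K (z XOR t) v * walsh K z' v))"
    by (subst sum.swap, rule sum.cong[OF refl], subst sum.swap)
      (simp add: sum_distrib_left walsh_commute)
  also have "\<dots> = (\<Sum>z<2 ^ K. \<Sum>z'<2 ^ K. if z' = z XOR t then S z * S z' * M else 0)"
    by (intro sum.cong refl)
      (auto simp: walsh_orthogonal xor_less_two_power t M_def)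
  also have "\<dots> = (\<Sum>z<2 ^ K. S z * S (z XOR t) * M)"
    by (intro sum.cong refl) (simp add: xor_less_two_power t)
  also have "\<dots> = (\<Sum>z<2 ^ K. if F z = F (z XOR t) then 1 else -1) * M"
    unfolding sum_distrib_right by (intro sum.cong) (auto simp: S_def)
  finally show ?thesis using M by (simp add: power2_eq_square M_def[symmetric])
qed

lemma sum_walsh_weight_1: "(\<Sum>v<2 ^ K. walsh_weight K F v) = 1"
  using sum_walsh_weight[of 0 K F] by simp

section \<open>Real quantum gates\<close>

definition real_mat :: "nat \<Rightarrow> (nat \<Rightarrow> nat \<Rightarrow> real) \<Rightarrow> complex mat" where
  "real_mat d g = mat d d (\<lambda>(r, c). complex_of_real (g r c))"

definition real_vec :: "nat \<Rightarrow> (nat \<Rightarrow> real) \<Rightarrow> complex vec" where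
  "real_vec d v = vec d (\<lambda>r. complex_of_real (v r))"

definition orthogonal_on :: "nat \<Rightarrow> (nat \<Rightarrow> nat \<Rightarrow> real) \<Rightarrow> bool" where
  "orthogonal_on d g \<longleftrightarrow> (\<forall>r<d. \<forall>c<d.
     (\<Sum>k<d. g r k * g c k) = of_bool (r = c) \<and> (\<Sum>k<d. g k r * g k c) = of_bool (r = c))"

lemma real_mat_dim [simp]: "dim_row (real_mat d g) = d" "dim_col (real_mat d g) = d"
  by (simp_all add: real_mat_def)

lemma real_mat_mult:
  "real_mat d g * real_mat d h = real_mat d (\<lambda>r c. \<Sum>k<d. g r k * h k c)"
  by (rule eq_matI) (auto simp: real_mat_def scalar_prod_def atLeast0LessThan)

lemma real_mat_mult_vec:
  "real_mat d g *\<^sub>v real_vec d v = real_vec d (\<lambda>r. \<Sum>k<d. g r k * v k)"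
  by (rule eq_vecI) (auto simp: real_mat_def real_vec_def scalar_prod_def atLeast0LessThan)

lemma mat_adjoint_real_mat: "mat_adjoint (real_mat d g) = real_mat d (\<lambda>r c. g c r)"
proof (rule eq_matI)
  fix i j assume "i < dim_row (real_mat d (\<lambda>r c. g c r))" "j < dim_col (real_mat d (\<lambda>r c. g c r))"
  then show "mat_adjoint (real_mat d g) $$ (i, j) = real_mat d (\<lambda>r c. g c r) $$ (i, j)"
    by (simp add: mat_adjoint_def mat_of_rows_def real_mat_def)
qed (simp_all add: mat_adjoint_def)

lemma real_mat_eq_one:
  assumes "\<And>r c. r < d \<Longrightarrow> c < d \<Longrightarrow> g r c = of_bool (r = c)"
  shows "real_mat d g = 1\<^sub>m d"
  by (rule eq_matI) (auto simp: real_mat_def assms)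

lemma is_unitary_real_mat: "orthogonal_on d g \<Longrightarrow> is_unitary d (real_mat d g)"
  unfolding is_unitary_def mat_adjoint_real_mat real_mat_mult
  by (auto simp: orthogonal_on_def carrier_matI intro!: real_mat_eq_one)

lemma unit_vec_eq_real_vec: "unit_vec d a = real_vec d (\<lambda>r. of_bool (r = a))"
  by (rule eq_vecI) (auto simp: real_vec_def unit_vec_def)

text \<open>With a work register of one basis state, a basis vector has position
  \<open>2 * i + b\<close>, so a query flips the lowest bit of the position.\<close>

definition flip_answer :: "bool list \<Rightarrow> nat \<Rightarrow> nat" where
  "flip_answer x r = (if x ! (r div 2) then r XOR 1 else r)"

lemma flip_answer_basis: "flip_answer x (i * 2 + of_bool b) = i * 2 + of_bool (b \<noteq> x ! i)"
  by (cases b) (auto simp: flip_answer_def xor_Suc_0_eq)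

lemma flip_answer_less: "r < N * 2 \<Longrightarrow> flip_answer x r < N * 2"
  by (auto simp: flip_answer_def xor_Suc_0_eq)

lemma query_op_eq: "query_op N 1 x = real_mat (N * 2) (\<lambda>r c. of_bool (c = flip_answer x r))"
proof (rule eq_matI)
  fix r c
  assume "r < dim_row (real_mat (N * 2) (\<lambda>r c. of_bool (c = flip_answer x r)))"
    and "c < dim_col (real_mat (N * 2) (\<lambda>r c. of_bool (c = flip_answer x r)))"
  then have rc: "r < N * 2" "c < N * 2" by auto
  have "(\<exists>i<N. \<exists>b. c = i * 2 + of_bool b \<and> r = i * 2 + of_bool (b \<noteq> x ! i)) \<longleftrightarrow> c = flip_answer x r"
  proof
    assume "\<exists>i<N. \<exists>b. c = i * 2 + of_bool b \<and> r = i * 2 + of_bool (b \<noteq> x ! i)"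
    then obtain i b where "c = i * 2 + of_bool b" "r = i * 2 + of_bool (b \<noteq> x ! i)" by blast
    then show "c = flip_answer x r" by (simp only: flip_answer_basis) auto
  next
    assume c: "c = flip_answer x r"
    define b where "b = odd r"
    have r: "r = r div 2 * 2 + of_bool b" by (cases "odd r") (auto simp: b_def elim!: oddE)
    have "c = r div 2 * 2 + of_bool (b \<noteq> x ! (r div 2))"
      using c r flip_answer_basis by metis
    moreover have "r div 2 < N" using rc by auto
    moreover have "r = r div 2 * 2 + of_bool ((b \<noteq> x ! (r div 2)) \<noteq> x ! (r div 2))"
      using r by (cases "x ! (r div 2)") simp_all
    ultimately show "\<exists>i<N. \<exists>b. c = i * 2 + of_bool b \<and> r = i * 2 + of_bool (b \<noteq> x ! i)"
      by blast
  qed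
  then show "query_op N 1 x $$ (r, c) =
      real_mat (N * 2) (\<lambda>r c. of_bool (c = flip_answer x r)) $$ (r, c)"
    using rc by (simp add: query_op_def real_mat_def basis_pos_def)
qed (simp_all add: query_op_def)

definition one_query :: "nat \<Rightarrow> (nat \<Rightarrow> nat \<Rightarrow> real) \<Rightarrow> (nat \<Rightarrow> nat \<Rightarrow> real) \<Rightarrow> qdt" where
  "one_query N g h = QDT 1 1 (\<lambda>j. if j = 0 then real_mat (N * 2) g else real_mat (N * 2) h)"

lemma one_query_sel [simp]:
  "num_queries (one_query N g h) = 1" "work_dim (one_query N g h) = 1"
  "qdt_dim N (one_query N g h) = N * 2"
  by (simp_all add: one_query_def qdt_dim_def)

lemma valid_one_query:
  "orthogonal_on (N * 2) g \<Longrightarrow> orthogonal_on (N * 2) h \<Longrightarrow> valid_qdt N (one_query N g h)"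
  by (auto simp: valid_qdt_def one_query_def qdt_dim_def is_unitary_real_mat)

text \<open>The initial state is the basis vector at position 0, so only column 0 of the first gate
  enters. The query permutes positions by an involution and hence acts on coefficients by
  composition with \<open>flip_answer x\<close> itself.\<close>

lemma qdt_prob_one_query:
  assumes "N > 0" "r < N * 2"
  shows "qdt_prob N (one_query N g h) x r = (\<Sum>k<N * 2. h r k * g (flip_answer x k) 0)\<^sup>2"
proof -
  let ?d = "N * 2"
  have s0: "qdt_state N (one_query N g h) x 0 = real_vec ?d (\<lambda>k. g k 0)"
    using assms unfolding qdt_state.simps
    by (simp add: one_query_def qdt_dim_def unit_vec_eq_real_vec real_mat_mult_vec basis_pos_def of_bool_def
        if_distrib [of "\<lambda>t. _ * t"] cong: if_cong)
  have q: "query_op N 1 x *\<^sub>v real_vec ?d v = real_vec ?d (\<lambda>k. v (flip_answer x k))" for v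
    unfolding query_op_eq real_mat_mult_vec
    by (rule eq_vecI) (auto simp: real_vec_def of_bool_def flip_answer_less if_distrib [of "\<lambda>t. t * _"] cong: if_cong)
  have "qdt_state N (one_query N g h) x 1
      = real_mat ?d h *\<^sub>v (query_op N 1 x *\<^sub>v real_vec ?d (\<lambda>k. g k 0))"
    unfolding One_nat_def qdt_state.simps(2) s0 by (simp add: one_query_def)
  also have "\<dots> = real_vec ?d (\<lambda>r. \<Sum>k<?d. h r k * g (flip_answer x k) 0)"
    by (simp only: q real_mat_mult_vec)
  finally show ?thesis
    using assms unfolding qdt_prob_def one_query_sel
    by (simp add: real_vec_def del: of_real_sum of_real_mult)
qed


section \<open>Programs with one-query quantum subroutines\<close>

abbreviation good_hdt :: "nat \<Rightarrow> nat \<Rightarrow> hdt \<Rightarrow> bool" where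
  "good_hdt N e T \<equiv> valid_hdt N T \<and> q_limited 1 T \<and> (\<forall>p \<in> path_costs T. p \<le> e)"

text \<open>A program is represented by its output distribution; \<open>Tf a\<close> is the tree that runs after the
  program has returned \<open>a\<close>.\<close>

definition implements :: "nat \<Rightarrow> nat \<Rightarrow> (bool list \<Rightarrow> 'a pmf) \<Rightarrow> bool" where
  "implements N d P \<longleftrightarrow> (\<forall>x \<in> bool_cube N. finite (set_pmf (P x))) \<and>
     (\<forall>e Tf. (\<forall>a. good_hdt N e (Tf a)) \<longrightarrow>
       (\<exists>T. good_hdt N (d + e) T \<and> (\<forall>x \<in> bool_cube N. \<forall>y.
         hdt_prob N T x y = measure_pmf.expectation (P x) (\<lambda>a. hdt_prob N (Tf a) x y))))"

lemma implementsD: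
  assumes "implements N d P" "\<And>a. good_hdt N e (Tf a)"
  obtains T where "good_hdt N (d + e) T" "\<And>x y. x \<in> bool_cube N \<Longrightarrow>
    hdt_prob N T x y = measure_pmf.expectation (P x) (\<lambda>a. hdt_prob N (Tf a) x y)"
  using assms unfolding implements_def by metis

lemma implements_finite: "implements N d P \<Longrightarrow> x \<in> bool_cube N \<Longrightarrow> finite (set_pmf (P x))"
  by (simp add: implements_def)

lemma implements_return: "implements N 0 (\<lambda>x. return_pmf a)"
  unfolding implements_def by (auto intro!: exI)

lemma implements_cong:
  assumes "implements N d P" "\<And>x. x \<in> bool_cube N \<Longrightarrow> P x = Q x"
  shows "implements N d Q"
  using assms unfolding implements_def by (auto cong: ball_cong)

lemma implements_mono:
  assumes "implements N d P" "d \<le> d'"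
  shows "implements N d' P"
  unfolding implements_def
proof (intro conjI allI impI ballI)
  fix e and Tf :: "'a \<Rightarrow> hdt" assume Tf: "\<forall>a. good_hdt N e (Tf a)"
  obtain T where T: "good_hdt N (d + e) T" "\<And>x y. x \<in> bool_cube N \<Longrightarrow>
      hdt_prob N T x y = measure_pmf.expectation (P x) (\<lambda>a. hdt_prob N (Tf a) x y)"
    using implementsD[OF assms(1)] Tf by metis
  moreover have "good_hdt N (d' + e) T" using T(1) assms(2) by fastforce
  ultimately show "\<exists>T. good_hdt N (d' + e) T \<and> (\<forall>x \<in> bool_cube N. \<forall>y.
         hdt_prob N T x y = measure_pmf.expectation (P x) (\<lambda>a. hdt_prob N (Tf a) x y))"
    by blast
qed (use assms implements_finite in blast)

text \<open>Continuations compose: the trees built for \<open>Q a\<close> in front of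
  \<open>Tf\<close> serve as the continuation of \<open>P\<close>. Finite support turns the nested
  expectations into finite sums.\<close>

lemma implements_bind:
  assumes P: "implements N d P" and Q: "\<And>a. implements N d' (Q a)"
  shows "implements N (d + d') (\<lambda>x. bind_pmf (P x) (\<lambda>a. Q a x))"
  unfolding implements_def
proof (intro conjI allI impI ballI)
  fix x assume "x \<in> bool_cube N"
  then show "finite (set_pmf (bind_pmf (P x) (\<lambda>a. Q a x)))"
    using implements_finite[OF P] implements_finite[OF Q] by auto
next
  fix e and Tf :: "'b \<Rightarrow> hdt" assume Tf: "\<forall>a. good_hdt N e (Tf a)"
  have "\<exists>T. good_hdt N (d' + e) T \<and> (\<forall>x \<in> bool_cube N. \<forall>y.
      hdt_prob N T x y = measure_pmf.expectation (Q a x) (\<lambda>a. hdt_prob N (Tf a) x y))" for a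
    using implementsD[OF Q[of a], of Tf e] Tf by metis
  then obtain Tg where Tg: "\<And>a. good_hdt N (d' + e) (Tg a)" "\<And>a x y. x \<in> bool_cube N \<Longrightarrow>
      hdt_prob N (Tg a) x y = measure_pmf.expectation (Q a x) (\<lambda>a. hdt_prob N (Tf a) x y)"
    by metis
  obtain T where T: "good_hdt N (d + (d' + e)) T" "\<And>x y. x \<in> bool_cube N \<Longrightarrow>
      hdt_prob N T x y = measure_pmf.expectation (P x) (\<lambda>a. hdt_prob N (Tg a) x y)"
    by (rule implementsD[OF P, where Tf = Tg and e = "d' + e"]) (use Tg(1) in blast)+
  have "hdt_prob N T x y = measure_pmf.expectation (bind_pmf (P x) (\<lambda>a. Q a x)) (\<lambda>a. hdt_prob N (Tf a) x y)"
    if x: "x \<in> bool_cube N" for x y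
  proof -
    have fin: "finite (set_pmf (P x))" using implements_finite P x by blast
    have "hdt_prob N T x y = (\<Sum>a\<in>set_pmf (P x). pmf (P x) a * hdt_prob N (Tg a) x y)"
      using fin by (subst T(2)[OF x], subst integral_measure_pmf[of "set_pmf (P x)"]) auto
    also have "\<dots> = measure_pmf.expectation (bind_pmf (P x) (\<lambda>a. Q a x)) (\<lambda>a. hdt_prob N (Tf a) x y)"
      using fin by (subst pmf_expectation_bind[of "set_pmf (P x)"])
        (auto simp: Tg(2)[OF x] intro: implements_finite[OF Q x])
    finally show ?thesis .
  qed
  then show "\<exists>T. good_hdt N (d + d' + e) T \<and> (\<forall>x \<in> bool_cube N. \<forall>y.
      hdt_prob N T x y = measure_pmf.expectation (bind_pmf (P x) (\<lambda>a. Q a x)) (\<lambda>a. hdt_prob N (Tf a) x y))"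
    using T(1) by (auto simp: add.assoc)
qed

lemma implements_map:
  assumes "implements N d P"
  shows "implements N d (\<lambda>x. map_pmf h (P x))"
  using implements_bind[OF assms implements_return[of N "h _"]] by (simp add: map_pmf_def)

lemma path_costs_finite: "N > 0 \<Longrightarrow> valid_hdt N T \<Longrightarrow> finite (path_costs T) \<and> path_costs T \<noteq> {}"
proof (induction T)
  case (Node A ts)
  then have "ts \<noteq> []" by (auto simp: qdt_dim_def valid_qdt_def)
  then obtain t where "t \<in> set ts" by (cases ts) auto
  with Node show ?case by auto
qed simp

lemma H_query_le:
  assumes "N > 0" and P: "implements N d P"
    and f: "\<And>x. x \<in> bool_cube N \<Longrightarrow> pmf (P x) (f x) \<ge> 2 / 3"
  shows "H_query 1 N (bool_cube N) f \<le> d"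
proof -
  obtain T where T: "good_hdt N (d + 0) T" "\<And>x y. x \<in> bool_cube N \<Longrightarrow>
      hdt_prob N T x y = measure_pmf.expectation (P x) (\<lambda>a. hdt_prob N (Leaf a) x y)"
    using implementsD[OF P, where e = 0 and Tf = Leaf] by auto
  have "hdt_computes N T (bool_cube N) f"
    unfolding hdt_computes_def
  proof
    fix x assume x: "x \<in> bool_cube N"
    have "hdt_prob N T x (f x) = measure_pmf.expectation (P x) (indicator {f x})"
      unfolding T(2)[OF x] by (rule Bochner_Integration.integral_cong) (auto simp: indicator_def)
    also have "\<dots> = pmf (P x) (f x)" by (simp add: measure_pmf_single)
    finally show "hdt_prob N T x (f x) \<ge> 2 / 3" using f[OF x] by simp
  qed
  then have "H_query 1 N (bool_cube N) f \<le> hdt_cost T"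
    unfolding H_query_def using T(1) by (intro Least_le) blast
  also have "hdt_cost T \<le> d"
    using path_costs_finite[OF assms(1)] T(1) by (auto simp: hdt_cost_def)
  finally show ?thesis .
qed

lemma implements_one_query:
  assumes "N > 0" "orthogonal_on (N * 2) g" "orthogonal_on (N * 2) h"
    and P: "\<And>x. x \<in> bool_cube N \<Longrightarrow> set_pmf (P x) \<subseteq> {..<N * 2}"
    "\<And>x r. x \<in> bool_cube N \<Longrightarrow> r < N * 2 \<Longrightarrow>
       pmf (P x) r = (\<Sum>k<N * 2. h r k * g (flip_answer x k) 0)\<^sup>2"
  shows "implements N 1 P"
  unfolding implements_def
proof (intro conjI allI impI ballI)
  fix x assume "x \<in> bool_cube N"
  then show "finite (set_pmf (P x))" using P(1) finite_subset by blast
next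
  fix e and Tf :: "nat \<Rightarrow> hdt" assume Tf: "\<forall>a. good_hdt N e (Tf a)"
  let ?T = "Node (one_query N g h) (map Tf [0..<N * 2])"
  have "good_hdt N (1 + e) ?T"
    using Tf valid_one_query[OF assms(2,3)] by auto
  moreover have "hdt_prob N ?T x y = measure_pmf.expectation (P x) (\<lambda>a. hdt_prob N (Tf a) x y)"
    if x: "x \<in> bool_cube N" for x y
    using P(1)[OF x]
    by (subst integral_measure_pmf[of "{..<N * 2}"]) (auto simp: qdt_prob_one_query[OF assms(1)] P(2)[OF x])
  ultimately show "\<exists>T. good_hdt N (1 + e) T \<and> (\<forall>x \<in> bool_cube N. \<forall>y.
         hdt_prob N T x y = measure_pmf.expectation (P x) (\<lambda>a. hdt_prob N (Tf a) x y))"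
    by blast
qed

section \<open>Reading input bits with one-query circuits\<close>

lemma orthogonal_on_permuted_identity:
  assumes "bij_betw p {..<d} {..<d}"
  shows "orthogonal_on d (\<lambda>r c. of_bool (r = p c))"
  unfolding orthogonal_on_def
proof (intro allI impI conjI)
  fix r c assume rc: "r < d" "c < d"
  have "(\<Sum>k<d. of_bool (r = p k) * of_bool (c = p k))
      = (\<Sum>k<d. of_bool (r = k) * of_bool (c = k) :: real)"
    using sum.reindex_bij_betw[OF assms, of "\<lambda>k. of_bool (r = k) * of_bool (c = k) :: real"] by simp
  also have "\<dots> = of_bool (r = c)"
    using rc by (simp add: of_bool_def if_distrib [of "\<lambda>t. t * _"] cong: if_cong)
  finally show "(\<Sum>k<d. of_bool (r = p k) * of_bool (c = p k)) = (of_bool (r = c) :: real)" .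
  have "p r = p c \<longleftrightarrow> r = c" "p r < d"
    using assms rc by (auto simp: bij_betw_def inj_on_def)
  then show "(\<Sum>k<d. of_bool (k = p r) * of_bool (k = p c)) = (of_bool (r = c) :: real)"
    by (simp add: of_bool_def if_distrib [of "\<lambda>t. t * _"] cong: if_cong)
qed

definition swap_zero :: "nat \<Rightarrow> nat \<Rightarrow> nat" where
  "swap_zero b k = (if k = 0 then b else if k = b then 0 else k)"

lemma bij_betw_swap_zero: "b < d \<Longrightarrow> bij_betw (swap_zero b) {..<d} {..<d}"
  by (rule bij_betwI[where g = "swap_zero b"]) (auto simp: swap_zero_def)

lemma flip_answer_involution: "flip_answer x (flip_answer x r) = r"
proof -
  have "flip_answer x r div 2 = r div 2"
    by (auto simp: flip_answer_def xor_div_2)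
  then show ?thesis by (auto simp: flip_answer_def)
qed

lemma implements_read:
  assumes "i < N"
  shows "implements N 1 (\<lambda>x. return_pmf (x ! i))"
proof -
  \<comment> \<open>The first gate moves the start position 0 to index \<open>i\<close> with answer
    bit 0; after the query the outcome is odd exactly if \<open>x ! i\<close> holds.\<close>
  define p where "p = swap_zero (i * 2)"
  define a where "a x = i * 2 + of_bool (x ! i)" for x :: "bool list"
  have p: "bij_betw p {..<N * 2} {..<N * 2}"
    unfolding p_def using assms by (intro bij_betw_swap_zero) auto
  have "implements N 1 (\<lambda>x. return_pmf (a x))"
  proof (rule implements_one_query)
    show "orthogonal_on (N * 2) (\<lambda>r c. of_bool (r = p c))"
      by (rule orthogonal_on_permuted_identity[OF p])
    show "orthogonal_on (N * 2) (\<lambda>r c. of_bool (r = c))"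
      using orthogonal_on_permuted_identity[of "\<lambda>x. x" "N * 2"] by (simp add: bij_betw_def inj_on_def)
    fix x :: "bool list"
    have ax: "a x < N * 2" using assms by (auto simp: a_def)
    then show "set_pmf (return_pmf (a x)) \<subseteq> {..<N * 2}" by simp
    have fa: "flip_answer x (i * 2) = a x"
      using flip_answer_basis[of x i False] by (simp add: a_def)
    fix r assume r: "r < N * 2"
    have "(\<Sum>k<N * 2. of_bool (r = k) * of_bool (flip_answer x k = p 0))
        = (of_bool (flip_answer x r = i * 2) :: real)"
      using r by (simp add: p_def swap_zero_def of_bool_def if_distrib [of "\<lambda>t. t * _"] cong: if_cong)
    also have "flip_answer x r = i * 2 \<longleftrightarrow> r = a x"
      using fa flip_answer_involution by metis
    finally show "pmf (return_pmf (a x)) r =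
        (\<Sum>k<N * 2. of_bool (r = k) * of_bool (flip_answer x k = p 0))\<^sup>2"
      by (simp add: indicator_def)
  qed (use assms in auto)
  from implements_map[OF this, of odd] show ?thesis
    by (simp add: a_def)
qed

lemma implements_read_list:
  assumes "\<And>i. i \<in> set ps \<Longrightarrow> i < N"
  shows "implements N (length ps) (\<lambda>x. return_pmf (map ((!) x) ps))"
  using assms
proof (induction ps)
  case (Cons i ps)
  have "implements N (1 + (length ps + 0)) (\<lambda>x. bind_pmf (return_pmf (x ! i))
      (\<lambda>a. bind_pmf (return_pmf (map ((!) x) ps)) (\<lambda>as. return_pmf (a # as))))"
    by (intro implements_bind implements_read implements_return) (use Cons in auto)
  then show ?case by (simp add: bind_return_pmf)
qed (simp add: implements_return)

text \<open>The answers determine \<open>g x\<close>: every input in the cube with the same answers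
  has the same value, so any such input can be chosen to evaluate \<open>g\<close>.\<close>

lemma implements_local:
  assumes "\<And>i. i \<in> set ps \<Longrightarrow> i < N"
    and "\<And>x y. x \<in> bool_cube N \<Longrightarrow> y \<in> bool_cube N \<Longrightarrow> (\<And>i. i \<in> set ps \<Longrightarrow> x ! i = y ! i) \<Longrightarrow> g x = g y"
  shows "implements N (length ps) (\<lambda>x. return_pmf (g x))"
proof -
  define h where "h as = g (SOME y. y \<in> bool_cube N \<and> map ((!) y) ps = as)" for as
  have "h (map ((!) x) ps) = g x" if x: "x \<in> bool_cube N" for x
  proof -
    define z where "z = (SOME y. y \<in> bool_cube N \<and> map ((!) y) ps = map ((!) x) ps)"
    have "z \<in> bool_cube N \<and> map ((!) z) ps = map ((!) x) ps"
      unfolding z_def by (rule someI[of _ x]) (use x in auto)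
    then have "g z = g x" using x by (intro assms(2)) auto
    then show ?thesis by (simp add: h_def z_def)
  qed
  moreover have "implements N (length ps) (\<lambda>x. map_pmf h (return_pmf (map ((!) x) ps)))"
    by (intro implements_map implements_read_list assms)
  ultimately show ?thesis by (auto intro: implements_cong)
qed

primrec sequence_pmf :: "'a pmf list \<Rightarrow> 'a list pmf" where
  "sequence_pmf [] = return_pmf []"
| "sequence_pmf (p # ps) = map_pmf (\<lambda>(a, as). a # as) (pair_pmf p (sequence_pmf ps))"

lemma implements_sequence:
  assumes "\<And>a. a \<in> set as \<Longrightarrow> implements N d (P a)"
  shows "implements N (length as * d) (\<lambda>x. sequence_pmf (map (\<lambda>a. P a x) as))"
  using assms
proof (induction as)
  case (Cons a as)
  have "implements N (d + (length as * d + 0)) (\<lambda>x. bind_pmf (P a x)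
      (\<lambda>b. bind_pmf (sequence_pmf (map (\<lambda>a. P a x) as)) (\<lambda>bs. return_pmf (b # bs))))"
    by (intro implements_bind implements_return) (use Cons in auto)
  then show ?case
    by (simp add: pair_pmf_def map_pmf_def bind_assoc_pmf bind_return_pmf)
qed (simp add: implements_return)

lemma length_sequence_pmf: "ys \<in> set_pmf (sequence_pmf ps) \<Longrightarrow> length ys = length ps"
  by (induction ps arbitrary: ys) auto

lemma prob_sequence_pmf:
  fixes P :: "'a \<Rightarrow> 'b :: countable pmf"
  shows "measure_pmf.prob (sequence_pmf (map P as)) {ys. list_all2 (\<lambda>a y. y \<in> A a) as ys} =
    (\<Prod>a\<leftarrow>as. measure_pmf.prob (P a) (A a))"
proof (induction as)
  case (Cons a as)
  have "(\<lambda>(b, bs). b # bs) -` {ys. list_all2 (\<lambda>a y. y \<in> A a) (a # as) ys} =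
      A a \<times> {ys. list_all2 (\<lambda>a y. y \<in> A a) as ys}"
    by auto
  then show ?case
    using Cons by (simp add: measure_pmf_prob_product)
qed (simp add: measure_return_pmf indicator_def)

section \<open>Fourier sampling with one query\<close>

definition walsh_pmf :: "nat \<Rightarrow> (nat \<Rightarrow> bool) \<Rightarrow> nat pmf" where
  "walsh_pmf K F = embed_pmf (\<lambda>v. if v < 2 ^ K then walsh_weight K F v else 0)"

lemma pmf_walsh_pmf: "pmf (walsh_pmf K F) v = (if v < 2 ^ K then walsh_weight K F v else 0)"
  unfolding walsh_pmf_def
proof (rule pmf_embed_pmf)
  let ?f = "\<lambda>v. if v < 2 ^ K then walsh_weight K F v else 0"
  have "(\<integral>\<^sup>+ v. ennreal (?f v) \<partial>count_space UNIV) = (\<Sum>v<2 ^ K. ennreal (?f v))"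
    by (rule nn_integral_count_space') (auto split: if_splits)
  also have "\<dots> = ennreal (\<Sum>v<2 ^ K. walsh_weight K F v)"
    by (subst sum_ennreal) (auto simp: walsh_weight_nonneg)
  finally show "(\<integral>\<^sup>+ v. ennreal (?f v) \<partial>count_space UNIV) = 1"
    by (simp add: sum_walsh_weight_1)
qed (simp add: walsh_weight_nonneg)

lemma set_walsh_pmf: "set_pmf (walsh_pmf K F) \<subseteq> {..<2 ^ K}"
  by (auto simp: set_pmf_eq pmf_walsh_pmf split: if_splits)

text \<open>The indicator of \<open>walsh K v t = 1\<close> is half of
  \<open>1 + walsh K v t\<close>, so the probability reduces to the autocorrelation at
  \<open>t\<close>.\<close>

lemma prob_walsh_pmf_eq_1:
  assumes "t < 2 ^ K"
  shows "measure_pmf.prob (walsh_pmf K F) {v. walsh K v t = 1} =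
    (1 + (\<Sum>z<2 ^ K. if F z = F (z XOR t) then 1 else -1) / 2 ^ K) / 2"
proof -
  have "measure_pmf.prob (walsh_pmf K F) {v. walsh K v t = 1}
      = measure_pmf.expectation (walsh_pmf K F) (indicator {v. walsh K v t = 1})"
    by simp
  also have "\<dots> = (\<Sum>v<2 ^ K. walsh_weight K F v * indicator {v. walsh K v t = 1} v)"
    using set_walsh_pmf[of K F]
    by (subst integral_measure_pmf[of "{..<2 ^ K}"]) (auto simp: pmf_walsh_pmf)
  also have "\<dots> = (\<Sum>v<2 ^ K. (walsh_weight K F v + walsh_weight K F v * walsh K v t) / 2)"
  proof (rule sum.cong[OF refl])
    fix v
    show "walsh_weight K F v * indicator {v. walsh K v t = 1} v =
        (walsh_weight K F v + walsh_weight K F v * walsh K v t) / 2"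
      using walsh_cases[of K v t] by (auto simp: indicator_def)
  qed
  also have "\<dots> = (1 + (\<Sum>z<2 ^ K. if F z = F (z XOR t) then 1 else -1) / 2 ^ K) / 2"
    by (simp add: sum_divide_distrib[symmetric] sum.distrib sum_walsh_weight_1 sum_walsh_weight[OF assms])
  finally show ?thesis .
qed

text \<open>The Walsh-Hadamard transform on a window of \<open>2 ^ K\<close> positions, and the
  identity elsewhere. In the application the window holds the indices of one cell together with the
  answer bit.\<close>

definition walsh_gate :: "nat \<Rightarrow> nat \<Rightarrow> nat \<Rightarrow> nat \<Rightarrow> real" where
  "walsh_gate a K r c = (if r \<in> {a..<a + 2 ^ K} \<and> c \<in> {a..<a + 2 ^ K}
     then walsh K (r - a) (c - a) / sqrt (2 ^ K) else of_bool (r = c))"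

lemma walsh_gate_commute: "walsh_gate a K r c = walsh_gate a K c r"
  by (auto simp: walsh_gate_def walsh_commute)

lemma sum_walsh_gate:
  assumes "a + 2 ^ K \<le> d" "r < d"
  shows "(\<Sum>k<d. walsh_gate a K r k * f k) = (if r \<in> {a..<a + 2 ^ K}
    then (\<Sum>z<2 ^ K. walsh K (r - a) z / sqrt (2 ^ K) * f (a + z)) else f r)"
proof (cases "r \<in> {a..<a + 2 ^ K}")
  case True
  have "(\<Sum>k<d. walsh_gate a K r k * f k) = (\<Sum>k\<in>{a..<a + 2 ^ K}. walsh_gate a K r k * f k)"
    using assms True by (intro sum.mono_neutral_right) (auto simp: walsh_gate_def)
  also have "\<dots> = (\<Sum>z<2 ^ K. walsh_gate a K r (a + z) * f (a + z))"
    using sum.shift_bounds_nat_ivl[of "\<lambda>k. walsh_gate a K r k * f k" 0 a "2 ^ K"]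
    by (simp add: atLeast0LessThan ac_simps)
  also have "\<dots> = (\<Sum>z<2 ^ K. walsh K (r - a) z / sqrt (2 ^ K) * f (a + z))"
    using True by (intro sum.cong) (auto simp: walsh_gate_def)
  finally show ?thesis using True by simp
next
  case False
  then have "walsh_gate a K r k = of_bool (r = k)" for k
    by (simp only: walsh_gate_def simp_thms if_False)
  then have "(\<Sum>k<d. walsh_gate a K r k * f k) = f r"
    using assms(2) by (simp add: of_bool_def if_distrib [of "\<lambda>t. t * _"] cong: if_cong)
  then show ?thesis by (simp only: False if_False)
qed

lemma walsh_gate_orthogonal:
  assumes "a + 2 ^ K \<le> d" "r < d" "c < d"
  shows "(\<Sum>k<d. walsh_gate a K r k * walsh_gate a K c k) = of_bool (r = c)"
proof -
  let ?B = "{a..<a + 2 ^ K}"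
  have "(\<Sum>k<d. walsh_gate a K r k * walsh_gate a K c k) = (if r \<in> ?B
      then (\<Sum>z<2 ^ K. walsh K (r - a) z / sqrt (2 ^ K) * walsh_gate a K c (a + z))
      else walsh_gate a K c r)"
    by (rule sum_walsh_gate[OF assms(1,2)])
  also have "\<dots> = of_bool (r = c)"
  proof (cases "r \<in> ?B \<and> c \<in> ?B")
    case True
    then have "(\<Sum>z<2 ^ K. walsh K (r - a) z / sqrt (2 ^ K) * walsh_gate a K c (a + z))
        = (\<Sum>z<2 ^ K. walsh K (r - a) z * walsh K (c - a) z / 2 ^ K)"
      by (intro sum.cong) (auto simp: walsh_gate_def)
    also have "\<dots> = (\<Sum>z<2 ^ K. walsh K (r - a) z * walsh K (c - a) z) / 2 ^ K"
      by (rule sum_divide_distrib[symmetric])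
    also have "\<dots> = of_bool (r = c)"
      using True by (subst walsh_orthogonal) auto
    finally show ?thesis using True by simp
  next
    case False
    then show ?thesis by (auto simp: walsh_gate_def intro!: sum.neutral)
  qed
  finally show ?thesis .
qed

lemma walsh_1_1: "K > 0 \<Longrightarrow> walsh K 1 1 = -1"
proof -
  assume "K > 0"
  have "walsh K 1 1 = (\<Prod>j<K. if j = 0 then -1 else 1)"
    unfolding walsh_def by (intro prod.cong) (auto simp: bit_Suc_0_iff)
  also have "\<dots> = -1" using \<open>K > 0\<close> by simp
  finally show ?thesis .
qed

lemma double_add_xor_1: "(2 * i + z) XOR 1 = 2 * i + (z XOR 1 :: nat)"
  by (cases "even z") (auto simp: xor_Suc_0_eq elim!: evenE oddE)

text \<open>The query writes the input bit into the phase because the answer register is in the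
  minus state, which is why the outcome is shifted by 1.\<close>

lemma implements_fourier_sampling:
  assumes K: "K > 0" and o: "2 * i + 2 ^ K \<le> N * 2"
  shows "implements N 1 (\<lambda>x. walsh_pmf K (\<lambda>z. x ! (i + z div 2)))"
proof -
  define a where "a = 2 * i"
  define d where "d = N * 2"
  \<comment> \<open>Position \<open>a + 1\<close> is transformed into the signs
    \<open>walsh K z 1\<close>: a uniform superposition over the indices of the window with the
    answer register in the minus state.\<close>
  define p where "p = swap_zero (a + 1)"
  define shift where "shift v = a + (v XOR 1)" for v :: nat
  have K2: "(1::nat) < 2 ^ K" using K one_less_power[of "2::nat" K] by simp
  have a: "a + 2 ^ K \<le> d" using o by (simp add: a_def d_def)
  have p: "bij_betw p {..<d} {..<d}"
    unfolding p_def using a K2 by (intro bij_betw_swap_zero) auto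
  have inj: "inj shift"
    by (rule injI) (metis shift_def add_left_cancel xor_right_self)
  have "implements N 1 (\<lambda>x. map_pmf shift (walsh_pmf K (\<lambda>z. x ! (i + z div 2))))"
  proof (rule implements_one_query[where g = "\<lambda>r c. walsh_gate a K r (p c)" and h = "walsh_gate a K"])
    show "orthogonal_on (N * 2) (walsh_gate a K)"
      unfolding orthogonal_on_def d_def[symmetric]
      using walsh_gate_orthogonal[OF a] by (simp add: walsh_gate_commute[of a K _ _])
    show "orthogonal_on (N * 2) (\<lambda>r c. walsh_gate a K r (p c))"
      unfolding orthogonal_on_def d_def[symmetric]
    proof (intro allI impI conjI)
      fix r c assume rc: "r < d" "c < d"
      show "(\<Sum>k<d. walsh_gate a K r (p k) * walsh_gate a K c (p k)) = of_bool (r = c)"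
        using sum.reindex_bij_betw[OF p, of "\<lambda>k. walsh_gate a K r k * walsh_gate a K c k"]
        by (simp add: walsh_gate_orthogonal[OF a rc])
      have "p r = p c \<longleftrightarrow> r = c" "p r < d" "p c < d"
        using p rc by (auto simp: bij_betw_def inj_on_def)
      then show "(\<Sum>k<d. walsh_gate a K k (p r) * walsh_gate a K k (p c)) = of_bool (r = c)"
        using walsh_gate_orthogonal[OF a, of "p r" "p c"]
        by (simp add: walsh_gate_commute[of a K _ "p r"] walsh_gate_commute[of a K _ "p c"])
    qed
    fix x :: "bool list"
    define F where "F z = x ! (i + z div 2)" for z
    show "set_pmf (map_pmf shift (walsh_pmf K (\<lambda>z. x ! (i + z div 2)))) \<subseteq> {..<N * 2}"
    proof
      fix r assume "r \<in> set_pmf (map_pmf shift (walsh_pmf K (\<lambda>z. x ! (i + z div 2))))"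
      then obtain v where "v < 2 ^ K" "r = shift v" using set_walsh_pmf by fastforce
      then show "r \<in> {..<N * 2}"
        using xor_less_two_power[of v K 1] K2 a by (simp add: shift_def d_def)
    qed
    fix r assume r: "r < N * 2"
    have fl: "flip_answer x (a + z) = a + (if F z then z XOR 1 else z)" for z
      by (auto simp: flip_answer_def F_def a_def double_add_xor_1[unfolded One_nat_def])
    have g: "walsh_gate a K (flip_answer x (a + z)) (p 0) =
        walsh K z 1 * (if F z then -1 else 1) / sqrt (2 ^ K)" if "z < 2 ^ K" for z
      using xor_less_two_power[of z K 1] that K2 walsh_1_1[OF K]
      by (auto simp: fl walsh_gate_def p_def swap_zero_def walsh_xor_left)
    show "pmf (map_pmf shift (walsh_pmf K (\<lambda>z. x ! (i + z div 2)))) r =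
        (\<Sum>k<N * 2. walsh_gate a K r k * walsh_gate a K (flip_answer x k) (p 0))\<^sup>2"
    proof (cases "r \<in> {a..<a + 2 ^ K}")
      case True
      define v where "v = (r - a) XOR 1"
      have v: "v < 2 ^ K" unfolding v_def using True K2 by (intro xor_less_two_power) auto
      have rv: "r = shift v" using True by (simp add: shift_def v_def)
      have "(\<Sum>k<d. walsh_gate a K r k * walsh_gate a K (flip_answer x k) (p 0))
          = (\<Sum>z<2 ^ K. walsh K (r - a) z / sqrt (2 ^ K) * walsh_gate a K (flip_answer x (a + z)) (p 0))"
        using True r by (subst sum_walsh_gate[OF a]) (auto simp: d_def)
      also have "\<dots> = (\<Sum>z<2 ^ K. walsh K v z * (if F z then -1 else 1) / 2 ^ K)"
        by (intro sum.cong refl) (simp add: g v_def walsh_xor_left walsh_commute[of K _ "Suc 0"])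
      also have "\<dots> = (\<Sum>z<2 ^ K. walsh K v z * (if F z then -1 else 1)) / 2 ^ K"
        by (simp add: sum_divide_distrib)
      finally show ?thesis
        by (simp add: rv pmf_map_inj'[OF inj] pmf_walsh_pmf v walsh_weight_def F_def d_def)
    next
      case False
      \<comment> \<open>No amplitude leaves the window: a query only exchanges the two positions of
        one index, and both \<open>a\<close> and \<open>2 ^ K\<close> are even.\<close>
      have "r \<notin> shift ` set_pmf (walsh_pmf K (\<lambda>z. x ! (i + z div 2)))"
      proof
        assume "r \<in> shift ` set_pmf (walsh_pmf K (\<lambda>z. x ! (i + z div 2)))"
        then obtain v where "v < 2 ^ K" "r = shift v" using set_walsh_pmf by fastforce
        then show False using False xor_less_two_power[of v K 1] K2 by (simp add: shift_def)
      qed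
      moreover have "flip_answer x r \<notin> {a..<a + 2 ^ K}"
      proof
        assume "flip_answer x r \<in> {a..<a + 2 ^ K}"
        then obtain z where z: "flip_answer x r = a + z" "z < 2 ^ K"
          by (metis atLeastLessThan_iff le_Suc_ex nat_add_left_cancel_less)
        then have "r = a + (if F z then z XOR 1 else z)"
          using fl flip_answer_involution by metis
        then show False using False z xor_less_two_power[of z K 1] K2 by (auto split: if_splits)
      qed
      moreover have "p 0 = a + 1" by (simp add: p_def swap_zero_def)
      ultimately show ?thesis
        using r K2 False sum_walsh_gate[OF a, of r "\<lambda>k. walsh_gate a K (flip_answer x k) (p 0)"]
        by (auto simp: d_def pmf_map_outside walsh_gate_def)
    qed
  qed (use o K2 in auto)
  from implements_map[OF this, of "\<lambda>r. (r - a) XOR 1"] show ?thesis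
    by (simp add: map_pmf_comp shift_def)
qed

section \<open>The cheat sheet function\<close>

definition periodic :: "nat \<Rightarrow> (nat \<Rightarrow> bool) \<Rightarrow> bool" where
  "periodic n f \<longleftrightarrow> (\<exists>s\<in>{1..<n}. \<forall>y<n. f y = f (y XOR s))"

text \<open>The threshold \<open>n / 8\<close> serves both bounds. A random string disagrees with
  its shift on about half of the points, so it clears the threshold for all \<open>s\<close> with
  overwhelming probability; and a candidate \<open>s\<close> then survives one Fourier sample with
  probability at most \<open>7 / 8\<close>.\<close>

definition aperiodic :: "nat \<Rightarrow> (nat \<Rightarrow> bool) \<Rightarrow> bool" where
  "aperiodic n f \<longleftrightarrow> (\<forall>s\<in>{1..<n}. n \<le> 8 * card {y. y < n \<and> f y \<noteq> f (y XOR s)})"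

lemma pair_index_less:
  fixes a b :: nat
  assumes "a < A" "b < B"
  shows "a * B + b < A * B"
proof -
  have "a * B + b < Suc a * B" using assms(2) by simp
  also have "\<dots> \<le> A * B" using assms(1) by (intro mult_right_mono) auto
  finally show ?thesis .
qed

text \<open>The input consists of \<open>c\<close> blocks, each of which is an \<open>n\<close> by \<open>n\<close> array of cells with \<open>n\<close> bits, followed
  by \<open>2 ^ c\<close> pages with one mark per cell. A block encodes the AND over its rows of the OR over
  the row of the periodicity bits of the cells. Page \<open>b\<close> has to mark witnesses for the claim that
  the blocks encode the binary digits of \<open>b\<close>; a witness for either digit has \<open>n\<close> cells.\<close>

locale cheat_sheet =
  fixes u c :: nat
begin

text \<open>A power of two, so that XOR stays in range, and a square, so that the collision bound
  can use the integer root \<open>2 ^ u\<close>.\<close>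

definition n :: nat where "n = 2 ^ (2 * u)"

definition cells :: nat where "cells = c * n * n"

definition sheet :: nat where "sheet = cells * n"

definition input_size :: nat where "input_size = sheet + 2 ^ c * cells"

definition cell :: "(nat \<Rightarrow> bool) \<Rightarrow> nat \<Rightarrow> nat \<Rightarrow> bool" where
  "cell X e y = X (e * n + y)"

definition marked :: "nat \<Rightarrow> (nat \<Rightarrow> bool) \<Rightarrow> nat set" where
  "marked b X = {e. e < cells \<and> X (sheet + b * cells + e)}"

text \<open>The cap on the marks bounds the cost of verification: \<open>c * n\<close> cells of
  \<open>n\<close> bits are \<open>cells\<close> bits. It is met because a witness for either digit
  needs \<open>n\<close> cells per block.\<close>

definition certified :: "nat \<Rightarrow> (nat \<Rightarrow> bool) \<Rightarrow> bool" where
  "certified b X \<longleftrightarrow> card (marked b X) \<le> c * n \<and>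
     (\<forall>i<c. if bit b i
        then \<forall>r<n. \<exists>j<n. (i * n + r) * n + j \<in> marked b X \<and> periodic n (cell X ((i * n + r) * n + j))
        else \<exists>r<n. \<forall>j<n. (i * n + r) * n + j \<in> marked b X \<and> aperiodic n (cell X ((i * n + r) * n + j)))"

text \<open>Stated with an existential page because the blocks of an arbitrary input need not encode
  digits: cells may be neither periodic nor aperiodic. A certified page has a witness for every
  digit, so its number is forced by the blocks.\<close>

definition target :: "bool list \<Rightarrow> bool" where
  "target x \<longleftrightarrow> (\<exists>b<2 ^ c. certified b ((!) x))"

lemma n_pos [simp]: "n > 0"
  by (simp add: n_def)

lemma xor_less_n: "x < n \<Longrightarrow> y < n \<Longrightarrow> x XOR y < n"
  unfolding n_def by (rule xor_less_two_power)

lemma cell_index_less: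
  assumes "i < c" "r < n" "j < n"
  shows "(i * n + r) * n + j < cells"
proof -
  have "i * n + r < c * n"
    using assms pair_index_less by blast
  then show ?thesis
    unfolding cells_def using assms pair_index_less by blast
qed

lemma cell_bit_less: "e < cells \<Longrightarrow> y < n \<Longrightarrow> e * n + y < sheet"
  unfolding sheet_def by (rule pair_index_less)

lemma sheet_bit_less: "b < 2 ^ c \<Longrightarrow> e < cells \<Longrightarrow> sheet + b * cells + e < input_size"
  unfolding input_size_def using pair_index_less[of b "2 ^ c" e cells] by simp

text \<open>Verification looks only at the marks of one page and at the bits of the marked cells.
  This locality gives its query cost and the passage between lists and functions.\<close>

lemma certified_cong:
  assumes m: "marked b X = marked b Y"
    and XY: "\<And>e y. e \<in> marked b X \<Longrightarrow> y < n \<Longrightarrow> X (e * n + y) = Y (e * n + y)"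
  shows "certified b X \<longleftrightarrow> certified b Y"
proof -
  have eq: "cell X e y = cell Y e y" if "e \<in> marked b X" "y < n" for e y
    using XY[OF that] by (simp add: cell_def)
  have "periodic n (cell X e) \<longleftrightarrow> periodic n (cell Y e)" if "e \<in> marked b X" for e
    unfolding periodic_def using eq[OF that] xor_less_n by (intro bex_cong) auto
  then have 1: "e \<in> marked b X \<and> periodic n (cell X e) \<longleftrightarrow> e \<in> marked b X \<and> periodic n (cell Y e)" for e
    by blast
  have "aperiodic n (cell X e) \<longleftrightarrow> aperiodic n (cell Y e)" if e: "e \<in> marked b X" for e
  proof -
    have "{y. y < n \<and> cell X e y \<noteq> cell X e (y XOR s)} = {y. y < n \<and> cell Y e y \<noteq> cell Y e (y XOR s)}"
      if "s \<in> {1..<n}" for s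
      using eq[OF e] xor_less_n that by auto
    then show ?thesis unfolding aperiodic_def by auto
  qed
  then have 2: "e \<in> marked b X \<and> aperiodic n (cell X e) \<longleftrightarrow> e \<in> marked b X \<and> aperiodic n (cell Y e)" for e
    by blast
  show ?thesis
    unfolding certified_def m[symmetric] 1 2 ..
qed

end

section \<open>Decision trees on hidden inputs\<close>

text \<open>Inputs are functions on all coordinates here, so that hidden inputs need no list
  representation.\<close>

fun run :: "dtree \<Rightarrow> (nat \<Rightarrow> bool) \<Rightarrow> bool" where
  "run (Output b) X = b"
| "run (Query i l r) X = (if X i then run r X else run l X)"

fun queried :: "dtree \<Rightarrow> (nat \<Rightarrow> bool) \<Rightarrow> nat set" where
  "queried (Output b) X = {}"
| "queried (Query i l r) X = insert i (if X i then queried r X else queried l X)"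

text \<open>Repeated queries to a coordinate count each time, unlike in \<open>queried\<close>. This
  is the count that \<open>trunc\<close> limits: it stops with a dummy output in place of query
  number \<open>m + 1\<close> to \<open>R\<close>.\<close>

fun visits :: "nat set \<Rightarrow> dtree \<Rightarrow> (nat \<Rightarrow> bool) \<Rightarrow> nat" where
  "visits R (Output b) X = 0"
| "visits R (Query i l r) X = of_bool (i \<in> R) + (if X i then visits R r X else visits R l X)"

fun trunc :: "nat set \<Rightarrow> nat \<Rightarrow> dtree \<Rightarrow> dtree" where
  "trunc R m (Output b) = Output b"
| "trunc R m (Query i l r) =
     (if i \<notin> R then Query i (trunc R m l) (trunc R m r)
      else if m = 0 then Output False
      else Query i (trunc R (m - 1) l) (trunc R (m - 1) r))"

lemma dtree_eval_eq_run: "dtree_eval t x = run t ((!) x)"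
  by (induction t) auto

lemma run_cong: "(\<And>q. q \<in> queried t X \<Longrightarrow> X q = Y q) \<Longrightarrow> run t X = run t Y"
  by (induction t) (auto split: if_splits)

lemma run_cong_valid: "valid_dtree N t \<Longrightarrow> (\<And>q. q < N \<Longrightarrow> X q = Y q) \<Longrightarrow> run t X = run t Y"
  by (induction t) auto

lemma finite_queried [simp]: "finite (queried t X)"
  by (induction t) auto

lemma card_queried: "card (queried t X) \<le> dtree_depth t"
proof (induction t)
  case (Query i l r)
  have "card (queried (Query i l r) X) \<le> Suc (card (if X i then queried r X else queried l X))"
    by (simp add: card_insert_if)
  then show ?case using Query by (auto split: if_splits)
qed simp

lemma card_queried_trunc: "card (queried (trunc R m t) X \<inter> R) \<le> m"
proof (induction t arbitrary: m)
  case (Query i l r)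
  show ?case
  proof (cases "i \<in> R \<and> m \<noteq> 0")
    case True
    have "card (insert i (Q \<inter> R)) \<le> m" if "card (Q \<inter> R) \<le> m - 1" for Q
      using that True by (cases "finite (Q \<inter> R)") (auto simp: card_insert_if)
    then show ?thesis using True Query[of "m - 1"] by auto
  qed (use Query in auto)
qed simp

lemma queried_trunc: "visits R t X \<le> m \<Longrightarrow> queried (trunc R m t) X = queried t X"
  by (induction t arbitrary: m) auto

lemma sum_visits:
  assumes "finite W" "disjoint_family_on R W"
  shows "(\<Sum>w\<in>W. visits (R w) t X) \<le> dtree_depth t"
proof (induction t)
  case (Query i l r)
  have "(\<Sum>w\<in>W. of_bool (i \<in> R w)) \<le> (1 :: nat)"
  proof (cases "\<exists>w\<in>W. i \<in> R w")
    case True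
    then obtain w where "w \<in> W" "i \<in> R w" by blast
    then have "i \<in> R v \<longleftrightarrow> v = w" if "v \<in> W" for v
      using assms(2) that by (auto simp: disjoint_family_on_def)
    then have "(\<Sum>w\<in>W. of_bool (i \<in> R w)) = (\<Sum>v\<in>W. of_bool (v = w) :: nat)"
      by (intro sum.cong) auto
    then show ?thesis using assms(1) by (simp add: of_bool_def)
  qed simp
  then show ?case using Query by (cases "X i") (auto simp: sum.distrib)
qed simp

section \<open>Inputs drawn from a random set with identified coordinates\<close>

lemma card_image_le_kernel:
  assumes "finite Q" "\<And>q q'. q \<in> Q \<Longrightarrow> q' \<in> Q \<Longrightarrow> p q = p q' \<Longrightarrow> p' q = p' q'"
  shows "card (p' ` Q) \<le> card (p ` Q)"
proof -
  have "p' q = p' (inv_into Q p (p q))" if "q \<in> Q" for q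
    using that by (intro assms(2)) (auto simp: inv_into_into f_inv_into_f)
  then have "p' ` Q = (\<lambda>y. p' (inv_into Q p y)) ` p ` Q"
    unfolding image_image by (rule image_cong[OF refl])
  then show ?thesis using assms(1) by (simp add: card_image_le)
qed

lemma card_subsets_between:
  assumes "finite M" "A \<subseteq> M" "B \<subseteq> M"
  shows "card {G. G \<subseteq> M \<and> A \<subseteq> G \<and> G \<inter> B = {}} =
    (if A \<inter> B = {} then 2 ^ (card M - card A - card B) else 0)"
proof (cases "A \<inter> B = {}")
  case True
  have "bij_betw (\<lambda>G. G \<union> A) (Pow (M - A - B)) {G. G \<subseteq> M \<and> A \<subseteq> G \<and> G \<inter> B = {}}"
    by (rule bij_betwI[where g = "\<lambda>G. G - A"]) (use assms True in auto)
  moreover have "card (M - A - B) = card M - card A - card B"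
    using assms True
    by (subst card_Diff_subset; (subst card_Diff_subset)?) (auto intro: finite_subset)
  ultimately show ?thesis
    using True assms(1) by (simp add: bij_betw_same_card[symmetric] card_Pow)
next
  case False
  then have "{G. G \<subseteq> M \<and> A \<subseteq> G \<and> G \<inter> B = {}} = {}" by auto
  then show ?thesis using False by (simp only: card.empty if_False)
qed

definition same_kernel :: "(nat \<Rightarrow> nat) \<Rightarrow> (nat \<Rightarrow> nat) \<Rightarrow> nat set \<Rightarrow> bool" where
  "same_kernel p p' Q \<longleftrightarrow> (\<forall>q\<in>Q. \<forall>q'\<in>Q. p q = p q' \<longleftrightarrow> p' q = p' q')"

text \<open>Prescribed answers fix one membership bit per class of identified coordinates. The count
  is thus a power of two determined by the numbers of classes answered yes and no, or 0 if a class
  receives both answers. Outside \<open>M\<close> every answer is negative.\<close>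

lemma card_consistent:
  assumes "finite M" "finite Q0" "finite Q1"
    and "\<And>q. p q \<in> M \<longleftrightarrow> q \<in> M" "\<And>q. p' q \<in> M \<longleftrightarrow> q \<in> M"
    and K: "same_kernel p p' (Q0 \<union> Q1)"
  shows "card {G. G \<subseteq> M \<and> (\<forall>q\<in>Q1. p q \<in> G) \<and> (\<forall>q\<in>Q0. p q \<notin> G)} =
    card {G. G \<subseteq> M \<and> (\<forall>q\<in>Q1. p' q \<in> G) \<and> (\<forall>q\<in>Q0. p' q \<notin> G)}"
proof (cases "Q1 \<subseteq> M")
  case True
  have eq: "{G. G \<subseteq> M \<and> (\<forall>q\<in>Q1. f q \<in> G) \<and> (\<forall>q\<in>Q0. f q \<notin> G)} =
      {G. G \<subseteq> M \<and> f ` Q1 \<subseteq> G \<and> G \<inter> f ` (Q0 \<inter> M) = {}}"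
    if "\<And>q. f q \<in> M \<longleftrightarrow> q \<in> M" for f
    using that by blast
  have card: "card (p ` R) = card (p' ` R)" if R: "R \<subseteq> Q0 \<union> Q1" for R
  proof -
    have fin: "finite R" using R assms(2,3) finite_subset by blast
    have k: "p q = p q' \<longleftrightarrow> p' q = p' q'" if "q \<in> R" "q' \<in> R" for q q'
      using that R K unfolding same_kernel_def by blast
    show ?thesis
    proof (rule antisym)
      show "card (p ` R) \<le> card (p' ` R)"
        by (rule card_image_le_kernel[OF fin]) (simp add: k)
      show "card (p' ` R) \<le> card (p ` R)"
        by (rule card_image_le_kernel[OF fin]) (simp add: k)
    qed
  qed
  have "card (p ` Q1) = card (p' ` Q1)" "card (p ` (Q0 \<inter> M)) = card (p' ` (Q0 \<inter> M))"
    by (rule card; blast)+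
  moreover have "p ` Q1 \<inter> p ` (Q0 \<inter> M) = {} \<longleftrightarrow> p' ` Q1 \<inter> p' ` (Q0 \<inter> M) = {}"
    using K unfolding same_kernel_def by blast
  moreover have "f ` Q1 \<subseteq> M" "f ` (Q0 \<inter> M) \<subseteq> M" if "\<And>q. f q \<in> M \<longleftrightarrow> q \<in> M" for f :: "nat \<Rightarrow> nat"
    using that True by auto
  ultimately show ?thesis
    using assms(1,4,5) by (simp add: eq card_subsets_between)
next
  case False
  then have empty: "{G. G \<subseteq> M \<and> (\<forall>q\<in>Q1. f q \<in> G) \<and> (\<forall>q\<in>Q0. f q \<notin> G)} = {}"
    if "\<And>q. f q \<in> M \<longleftrightarrow> q \<in> M" for f
    using that by blast
  show ?thesis
    by (simp only: empty[OF assms(4)] empty[OF assms(5)])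
qed

text \<open>Each root-to-leaf path that satisfies \<open>\<Phi>\<close> is followed for equally many sets \<open>G\<close> under \<open>p\<close> and
  under \<open>p'\<close>, because only the kernel on the queried coordinates matters.\<close>

lemma card_queried_same_kernel_aux:
  assumes "finite M"
    and "\<And>q. p q \<in> M \<longleftrightarrow> q \<in> M" "\<And>q. p' q \<in> M \<longleftrightarrow> q \<in> M"
    and \<Phi>: "\<And>Q. \<Phi> Q \<Longrightarrow> same_kernel p p' Q"
    and "finite Q0" "finite Q1"
  shows "card {G. G \<subseteq> M \<and> (\<forall>q\<in>Q1. p q \<in> G) \<and> (\<forall>q\<in>Q0. p q \<notin> G) \<and>
      \<Phi> (Q0 \<union> Q1 \<union> queried t (\<lambda>q. p q \<in> G))} =
    card {G. G \<subseteq> M \<and> (\<forall>q\<in>Q1. p' q \<in> G) \<and> (\<forall>q\<in>Q0. p' q \<notin> G) \<and>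
      \<Phi> (Q0 \<union> Q1 \<union> queried t (\<lambda>q. p' q \<in> G))}"
  using assms(5,6)
proof (induction t arbitrary: Q0 Q1)
  case (Output b)
  show ?case
  proof (cases "\<Phi> (Q0 \<union> Q1)")
    case True
    then show ?thesis
      using card_consistent[OF assms(1) Output assms(2,3) \<Phi>[OF True]] by simp
  qed simp
next
  case (Query i l r)
  define S where "S t f Q0 Q1 = {G. G \<subseteq> M \<and> (\<forall>q\<in>Q1. f q \<in> G) \<and> (\<forall>q\<in>Q0. f q \<notin> G) \<and>
      \<Phi> (Q0 \<union> Q1 \<union> queried t (\<lambda>q. f q \<in> G))}" for t and f :: "nat \<Rightarrow> nat" and Q0 Q1
  have fin: "finite (S t f Q0 Q1)" for t f Q0 Q1
    using assms(1) by (auto simp: S_def intro: finite_subset[of _ "Pow M"])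
  have "S (Query i l r) f Q0 Q1 = S l f (insert i Q0) Q1 \<union> S r f Q0 (insert i Q1)" for f
    by (auto simp: S_def)
  moreover have "S l f (insert i Q0) Q1 \<inter> S r f Q0 (insert i Q1) = {}" for f
    by (auto simp: S_def)
  ultimately have "card (S (Query i l r) f Q0 Q1) =
      card (S l f (insert i Q0) Q1) + card (S r f Q0 (insert i Q1))" for f
    by (simp add: card_Un_disjoint fin)
  moreover have "card (S l p (insert i Q0) Q1) = card (S l p' (insert i Q0) Q1)"
    "card (S r p Q0 (insert i Q1)) = card (S r p' Q0 (insert i Q1))"
    using Query.IH(1)[of "insert i Q0" Q1] Query.IH(2)[of Q0 "insert i Q1"] Query.prems
    by (simp_all only: S_def finite_insert)
  ultimately have "card (S (Query i l r) p Q0 Q1) = card (S (Query i l r) p' Q0 Q1)" by simp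
  then show ?case by (simp only: S_def)
qed

lemma card_queried_same_kernel:
  assumes "finite M"
    and "\<And>q. p q \<in> M \<longleftrightarrow> q \<in> M" "\<And>q. p' q \<in> M \<longleftrightarrow> q \<in> M"
    and "\<And>Q. \<Phi> Q \<Longrightarrow> same_kernel p p' Q"
  shows "card {G \<in> Pow M. \<Phi> (queried t (\<lambda>q. p q \<in> G))} =
    card {G \<in> Pow M. \<Phi> (queried t (\<lambda>q. p' q \<in> G))}"
  using card_queried_same_kernel_aux[where t = t and \<Phi> = \<Phi>, OF assms finite.emptyI finite.emptyI]
  by simp

text \<open>Exchanging the value at \<open>j\<close> with an independent element of \<open>B\<close>
  is an involution, so the value of a uniform \<open>h\<close> at \<open>j\<close> may be drawn
  again.\<close>

lemma sum_resample:
  fixes F :: "('i \<Rightarrow> 'b) \<Rightarrow> nat"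
  assumes "finite I" "finite B" "j \<in> I"
  shows "(\<Sum>h\<in>Pi\<^sub>E I (\<lambda>_. B). F h) * card B = (\<Sum>h\<in>Pi\<^sub>E I (\<lambda>_. B). \<Sum>a\<in>B. F (h(j := a)))"
proof -
  let ?H = "Pi\<^sub>E I (\<lambda>_. B)"
  have mem: "h(j := a) \<in> ?H" if "h \<in> ?H" "a \<in> B" for h a
    using that assms(3) by (auto simp: PiE_iff extensional_def)
  have B: "h j \<in> B" if "h \<in> ?H" for h using that assms(3) by auto
  have "bij_betw (\<lambda>(h, a). (h(j := a), h j)) (?H \<times> B) (?H \<times> B)"
    by (rule bij_betwI[where g = "\<lambda>(h, a). (h(j := a), h j)"]) (use mem B in auto)
  from sum.reindex_bij_betw[OF this, of "\<lambda>(h, a). F h"]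
  have "(\<Sum>(h, a)\<in>?H \<times> B. F (h(j := a))) = (\<Sum>(h, a)\<in>?H \<times> B. F h)"
    by (simp add: case_prod_unfold)
  then show ?thesis
    by (simp add: sum.cartesian_product[symmetric] sum_distrib_left mult.commute)
qed

section \<open>Planted periods and collisions\<close>

context cheat_sheet
begin

text \<open>The outer \<open>mod n\<close> keeps the result in the same cell for every
  \<open>s\<close>, so facts about cells need no bound on the secrets.\<close>

definition shift :: "nat \<Rightarrow> nat \<Rightarrow> nat" where
  "shift s q = q div n * n + (q mod n XOR s) mod n"

text \<open>The coordinates that are identified when each row \<open>w \<in> S\<close> gets a hidden periodic cell \<open>fst (h w)\<close>
  with period \<open>snd (h w)\<close>. The rows of all blocks are numbered consecutively.\<close>

definition rep :: "(nat \<Rightarrow> nat \<times> nat) \<Rightarrow> nat set \<Rightarrow> nat \<Rightarrow> nat" where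
  "rep h S q = (if q div n div n \<in> S \<and> q div n mod n = fst (h (q div n div n))
     then min q (shift (snd (h (q div n div n))) q) else q)"

text \<open>Formulated with \<open>rep h {w}\<close>, so that the event depends only on the secret
  of row \<open>w\<close> and not on which rows are planted. The same event can then be compared
  with and without planting.\<close>

definition coll :: "(nat \<Rightarrow> nat \<times> nat) \<Rightarrow> nat \<Rightarrow> nat set \<Rightarrow> bool" where
  "coll h w Q \<longleftrightarrow> (\<exists>q\<in>Q. \<exists>q'\<in>Q. q \<noteq> q' \<and> q div n div n = w \<and> rep h {w} q = rep h {w} q')"

definition row_coords :: "nat \<Rightarrow> nat set" where
  "row_coords w = {q. q div n div n = w}"

abbreviation hidden_input :: "(nat \<Rightarrow> nat \<times> nat) \<Rightarrow> nat set \<Rightarrow> nat set \<Rightarrow> nat \<Rightarrow> bool" where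
  "hidden_input h S G q \<equiv> rep h S q \<in> G"

abbreviation "row_ids \<equiv> {..<c * n}"
abbreviation "seeds \<equiv> Pow {..<sheet}"
abbreviation "secrets \<equiv> {..<n} \<times> {1..<n}"
abbreviation "plants \<equiv> row_ids \<rightarrow>\<^sub>E secrets"

lemma shift_div: "shift s q div n = q div n"
  by (simp add: shift_def)

lemma rep_div: "rep h S q div n = q div n"
  by (auto simp: rep_def min_def shift_div)

lemma rep_sheet: "rep h S q \<in> {..<sheet} \<longleftrightarrow> q \<in> {..<sheet}"
  unfolding sheet_def by (metis lessThan_iff div_less_iff_less_mult n_pos rep_div)

lemma rep_cong: "(q div n div n \<in> S \<longleftrightarrow> q div n div n \<in> S') \<Longrightarrow> rep h S q = rep h S' q"
  by (simp add: rep_def)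

text \<open>Identification never joins different cells, so planting the rows of \<open>U\<close> can
  change the kernel on \<open>Q\<close> only through a pair inside one of these rows, and such a
  pair is a collision.\<close>

lemma same_kernel_rep:
  assumes "\<And>w. w \<in> U \<Longrightarrow> \<not> coll h w Q"
  shows "same_kernel (rep h S) (rep h (S - U)) Q"
  unfolding same_kernel_def
proof (intro ballI)
  fix q q' assume q: "q \<in> Q" "q' \<in> Q"
  show "rep h S q = rep h S q' \<longleftrightarrow> rep h (S - U) q = rep h (S - U) q'"
  proof (cases "q div n = q' div n")
    case True
    define w where "w = q div n div n"
    show ?thesis
    proof (cases "w \<in> S \<inter> U")
      case w: True
      have "rep h S q = rep h {w} q" "rep h S q' = rep h {w} q'"
        using w True by (auto intro!: rep_cong simp: w_def)
      moreover have "rep h (S - U) q = q" "rep h (S - U) q' = q'"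
        using w True by (auto simp: rep_def w_def)
      ultimately show ?thesis
        using assms[of w] w q unfolding coll_def w_def by auto
    next
      case False
      then have "rep h S q = rep h (S - U) q" "rep h S q' = rep h (S - U) q'"
        using True by (auto intro!: rep_cong simp: w_def)
      then show ?thesis by simp
    qed
  next
    case False
    then show ?thesis using rep_div by metis
  qed
qed

lemma card_plants_same_kernel:
  assumes "\<And>Q. \<Phi> Q \<Longrightarrow> (\<And>w. w \<in> U \<Longrightarrow> \<not> coll h w Q)"
  shows "card {G \<in> seeds. \<Phi> (queried t (hidden_input h S G))} =
    card {G \<in> seeds. \<Phi> (queried t (hidden_input h (S - U) G))}"
  using assms same_kernel_rep
  by (intro card_queried_same_kernel) (auto simp: rep_sheet[unfolded lessThan_iff])

lemma rep_eqD:
  assumes "q \<noteq> q'" "rep h {w} q = rep h {w} q'" "snd (h w) < n" "q div n div n = w"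
  shows "q div n = q' div n" "q div n = w * n + fst (h w)" "q mod n XOR q' mod n = snd (h w)"
proof -
  define s where "s = snd (h w)"
  show d: "q div n = q' div n" using assms(2) rep_div by metis
  have m: "q div n mod n = fst (h w)"
    using assms d by (auto simp: rep_def split: if_splits)
  then show "q div n = w * n + fst (h w)"
    using assms(4) by (metis div_mult_mod_eq)
  have "min q (shift s q) = min q' (shift s q')"
    using assms m d by (simp add: rep_def s_def)
  then have "q = shift s q' \<or> shift s q = q' \<or> shift s q = shift s q'"
    using assms(1) by (auto simp: min_def split: if_splits)
  then have "q mod n = shift s q' mod n \<or> shift s q mod n = q' mod n \<or> shift s q mod n = shift s q' mod n"
    by auto
  moreover have sm: "shift s p mod n = p mod n XOR s" for p
    using assms(3) by (simp add: shift_def s_def xor_less_n)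
  moreover have "q mod n \<noteq> q' mod n" using assms(1) d by (metis div_mult_mod_eq)
  ultimately have "q mod n = q' mod n XOR s \<or> q mod n XOR s = q' mod n"
    by (metis xor_right_self)
  then show "q mod n XOR q' mod n = snd (h w)"
    unfolding s_def by (metis xor.commute xor_left_self)
qed

text \<open>The quadratic bound \<open>card Q * card Q\<close> and the trivial bound
  \<open>n = 2 ^ u * 2 ^ u\<close> cross at \<open>card Q = 2 ^ u\<close>, and the smaller of the
  two never exceeds \<open>card Q * 2 ^ u\<close>. Linearity in \<open>card Q\<close> is what allows
  summation over the cells of a row.\<close>

lemma card_differences:
  assumes "finite Q"
  shows "card {s. s < n \<and> (\<exists>q\<in>Q. \<exists>q'\<in>Q. q mod n XOR q' mod n = s)} \<le> card Q * 2 ^ u"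
proof (cases "card Q \<le> 2 ^ u")
  case True
  have "card {s. s < n \<and> (\<exists>q\<in>Q. \<exists>q'\<in>Q. q mod n XOR q' mod n = s)}
      \<le> card ((\<lambda>(q, q'). q mod n XOR q' mod n) ` (Q \<times> Q))"
    using assms by (intro card_mono) auto
  also have "\<dots> \<le> card (Q \<times> Q)"
    using assms by (intro card_image_le) auto
  also have "\<dots> \<le> card Q * 2 ^ u"
    using True by (simp add: card_cartesian_product)
  finally show ?thesis .
next
  case False
  have "card {s. s < n \<and> (\<exists>q\<in>Q. \<exists>q'\<in>Q. q mod n XOR q' mod n = s)} \<le> card {..<n}"
    by (intro card_mono) auto
  also have "\<dots> = 2 ^ u * 2 ^ u" by (simp add: n_def mult_2 power_add)
  also have "\<dots> \<le> card Q * 2 ^ u" using False by simp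
  finally show ?thesis .
qed

text \<open>A collision needs two queried points in the hidden cell \<open>fst a\<close> that differ
  by \<open>snd a\<close>, so in each cell the bad periods are differences of queried offsets.
  Against \<open>n * (n - 1)\<close> secrets, a likely collision takes about
  \<open>n * 2 ^ u\<close> queries to the row.\<close>

lemma card_coll:
  assumes "finite Q"
  shows "card {a \<in> secrets. coll (h(w := a)) w Q} \<le> card (Q \<inter> row_coords w) * 2 ^ u"
proof -
  define Qc where "Qc j = {q \<in> Q. q div n = w * n + j}" for j
  define D where "D j = {s. s < n \<and> (\<exists>q\<in>Qc j. \<exists>q'\<in>Qc j. q mod n XOR q' mod n = s)}" for j
  have "{a \<in> secrets. coll (h(w := a)) w Q} \<subseteq> Sigma {..<n} D"
  proof
    fix a assume a: "a \<in> {a \<in> secrets. coll (h(w := a)) w Q}"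
    then obtain q q' where q: "q \<in> Q" "q' \<in> Q" "q \<noteq> q'" "q div n div n = w"
      "rep (h(w := a)) {w} q = rep (h(w := a)) {w} q'"
      by (auto simp: coll_def)
    have "snd ((h(w := a)) w) < n" using a by auto
    from rep_eqD[OF q(3,5) this q(4)]
    have "q div n = q' div n" "q div n = w * n + fst a" "q mod n XOR q' mod n = snd a"
      by simp_all
    then have "q \<in> Qc (fst a)" "q' \<in> Qc (fst a)" "q mod n XOR q' mod n = snd a"
      using q by (auto simp: Qc_def)
    then show "a \<in> Sigma {..<n} D"
      using a by (cases a) (auto simp: D_def)
  qed
  then have "card {a \<in> secrets. coll (h(w := a)) w Q} \<le> card (Sigma {..<n} D)"
    by (intro card_mono) (auto simp: D_def)
  also have "\<dots> = (\<Sum>j<n. card (D j))"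
    by (rule card_SigmaI) (auto simp: D_def)
  also have "\<dots> \<le> (\<Sum>j<n. card (Qc j) * 2 ^ u)"
    unfolding D_def using assms by (intro sum_mono card_differences) (simp add: Qc_def)
  also have "\<dots> = card (\<Union>j<n. Qc j) * 2 ^ u"
    using assms by (subst card_UN_disjoint) (auto simp: Qc_def sum_distrib_right)
  also have "\<dots> \<le> card (Q \<inter> row_coords w) * 2 ^ u"
    using assms by (intro mult_right_mono card_mono) (auto simp: Qc_def row_coords_def)
  finally show ?thesis .
qed

lemma card_seeds_not: "card {G \<in> seeds. \<not> P G} = 2 ^ sheet - card {G \<in> seeds. P G}"
proof -
  have "card (seeds - {G \<in> seeds. P G}) = card seeds - card {G \<in> seeds. P G}"
    by (intro card_Diff_subset) (auto intro: finite_subset[of _ seeds])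
  moreover have "seeds - {G \<in> seeds. P G} = {G \<in> seeds. \<not> P G}" by blast
  ultimately show ?thesis by (simp add: card_Pow)
qed

lemma finite_plants: "finite plants"
  by (intro finite_PiE) auto

lemma sum_card_swap:
  "finite A \<Longrightarrow> finite B \<Longrightarrow>
    (\<Sum>a\<in>A. card {b \<in> B. P a b}) = (\<Sum>b\<in>B. card {a \<in> A. P a b})"
  by (rule sum_multicount_gen) simp_all

lemma card_secrets: "card secrets = n * (n - 1)"
  by (simp add: card_cartesian_product)

text \<open>The secret of row \<open>w\<close> is averaged out: without row \<open>w\<close> planted the queries do not depend on
  \<open>h w\<close>, and planting it makes no difference to the tree before a collision in it.\<close>

lemma sum_coll_trunc:
  assumes w: "w \<in> row_ids"
  shows "(\<Sum>h\<in>plants. card {G \<in> seeds. coll h w (queried (trunc (row_coords w) m t) (hidden_input h row_ids G))})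
    * (n * (n - 1)) \<le> card plants * 2 ^ sheet * (m * 2 ^ u)"
proof -
  let ?Q = "\<lambda>h G. queried (trunc (row_coords w) m t) (hidden_input h (row_ids - {w}) G)"
  define F where "F h = card {G \<in> seeds. coll h w (?Q h G)}" for h
  have eq: "card {G \<in> seeds. coll h w (queried (trunc (row_coords w) m t) (hidden_input h row_ids G))} = F h" for h
  proof -
    \<comment> \<open>Planting and unplanting leave only collision-free counts unchanged, hence the
      passage to the complement.\<close>
    have "card {G \<in> seeds. \<not> \<not> coll h w (R G)} = 2 ^ sheet - card {G \<in> seeds. \<not> coll h w (R G)}" for R
      by (rule card_seeds_not)
    then have split: "card {G \<in> seeds. coll h w (R G)} = 2 ^ sheet - card {G \<in> seeds. \<not> coll h w (R G)}" for R
      by simp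
    show ?thesis
      unfolding F_def split
      using card_plants_same_kernel[of "\<lambda>Q. \<not> coll h w Q" "{w}" h "trunc (row_coords w) m t" row_ids] by simp
  qed
  have "(\<Sum>h\<in>plants. F h) * card secrets = (\<Sum>h\<in>plants. \<Sum>a\<in>secrets. F (h(w := a)))"
    by (rule sum_resample) (use w in auto)
  also have "\<dots> \<le> (\<Sum>h\<in>plants. 2 ^ sheet * (m * 2 ^ u))"
  proof (rule sum_mono)
    fix h
    have "?Q (h(w := a)) G = ?Q h G" for a G
    proof -
      have "rep (h(w := a)) (row_ids - {w}) q = rep h (row_ids - {w}) q" for q
        by (auto simp: rep_def)
      then show ?thesis by simp
    qed
    then have "(\<Sum>a\<in>secrets. F (h(w := a))) = (\<Sum>a\<in>secrets. card {G \<in> seeds. coll (h(w := a)) w (?Q h G)})"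
      by (simp add: F_def)
    also have "\<dots> = (\<Sum>G\<in>seeds. card {a \<in> secrets. coll (h(w := a)) w (?Q h G)})"
      by (rule sum_card_swap) auto
    also have "\<dots> \<le> (\<Sum>G\<in>seeds. m * 2 ^ u)"
    proof (rule sum_mono)
      fix G
      have "card {a \<in> secrets. coll (h(w := a)) w (?Q h G)} \<le> card (?Q h G \<inter> row_coords w) * 2 ^ u"
        by (rule card_coll) simp
      also have "\<dots> \<le> m * 2 ^ u"
        by (intro mult_right_mono card_queried_trunc) simp
      finally show "card {a \<in> secrets. coll (h(w := a)) w (?Q h G)} \<le> m * 2 ^ u" .
    qed
    also have "\<dots> = 2 ^ sheet * (m * 2 ^ u)" by (simp add: card_Pow)
    finally show "(\<Sum>a\<in>secrets. F (h(w := a))) \<le> 2 ^ sheet * (m * 2 ^ u)" .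
  qed
  also have "\<dots> = card plants * 2 ^ sheet * (m * 2 ^ u)" by simp
  finally show ?thesis unfolding eq card_secrets .
qed

text \<open>Markov's inequality on each path: at most \<open>T / m\<close> rows can receive more
  than \<open>m\<close> of its queries.\<close>

lemma sum_visits_gt:
  assumes "dtree_depth t \<le> T"
  shows "(\<Sum>w\<in>row_ids. card {G \<in> seeds. visits (row_coords w) t (X G) > m}) * m \<le> 2 ^ sheet * T"
proof -
  have "(\<Sum>w\<in>row_ids. card {G \<in> seeds. visits (row_coords w) t (X G) > m}) =
      (\<Sum>G\<in>seeds. card {w \<in> row_ids. visits (row_coords w) t (X G) > m})"
    by (rule sum_card_swap) auto
  also have "\<dots> * m = (\<Sum>G\<in>seeds. card {w \<in> row_ids. visits (row_coords w) t (X G) > m} * m)"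
    by (rule sum_distrib_right)
  also have "\<dots> \<le> (\<Sum>G\<in>seeds. T)"
  proof (rule sum_mono)
    fix G
    have "card {w \<in> row_ids. visits (row_coords w) t (X G) > m} * m
        = (\<Sum>w\<in>{w \<in> row_ids. visits (row_coords w) t (X G) > m}. m)" by simp
    also have "\<dots> \<le> (\<Sum>w\<in>{w \<in> row_ids. visits (row_coords w) t (X G) > m}. visits (row_coords w) t (X G))"
      by (intro sum_mono) auto
    also have "\<dots> \<le> (\<Sum>w\<in>row_ids. visits (row_coords w) t (X G))"
      by (intro sum_mono2) auto
    also have "\<dots> \<le> dtree_depth t"
      by (intro sum_visits) (auto simp: disjoint_family_on_def row_coords_def)
    finally show "card {w \<in> row_ids. visits (row_coords w) t (X G) > m} * m \<le> T" using assms by simp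
  qed
  also have "\<dots> = 2 ^ sheet * T" by (simp add: card_Pow)
  finally show ?thesis .
qed

text \<open>While the budget \<open>m\<close> in \<open>R\<close> is not exceeded, the truncated
  tree queries the same coordinates.\<close>

lemma card_coll_le:
  "card {G \<in> seeds. coll h w (queried t (X G))} \<le>
    card {G \<in> seeds. visits R t (X G) > m} + card {G \<in> seeds. coll h w (queried (trunc R m t) (X G))}"
proof -
  have "{G \<in> seeds. coll h w (queried t (X G))} \<subseteq> {G \<in> seeds. visits R t (X G) > m} \<union>
      {G \<in> seeds. coll h w (queried (trunc R m t) (X G))}"
  proof
    fix G assume "G \<in> {G \<in> seeds. coll h w (queried t (X G))}"
    then show "G \<in> {G \<in> seeds. visits R t (X G) > m} \<union> {G \<in> seeds. coll h w (queried (trunc R m t) (X G))}"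
      by (cases "visits R t (X G) > m") (auto simp: queried_trunc not_less)
  qed
  then have "card {G \<in> seeds. coll h w (queried t (X G))} \<le> card ({G \<in> seeds. visits R t (X G) > m} \<union>
      {G \<in> seeds. coll h w (queried (trunc R m t) (X G))})"
    by (intro card_mono) (auto intro: finite_subset[of _ seeds])
  then show ?thesis using card_Un_le order_trans by blast
qed

text \<open>Rows that exceed the budget are charged to the depth, which gives \<open>T / m\<close>;
  every row also contributes the collisions of its truncated tree, which give the second term. The
  choice of \<open>m\<close> balances the two.\<close>

lemma sum_coll:
  assumes T: "dtree_depth t \<le> T" and m: "m > 0" and u: "u > 0"
  shows "(\<Sum>w\<in>row_ids. \<Sum>h\<in>plants. real (card {G \<in> seeds. coll h w (queried t (hidden_input h row_ids G))}))
    \<le> real (card plants) * 2 ^ sheet * (T / m + c * n * (m * 2 ^ u) / (n * (real n - 1)))"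
proof -
  have n1: "real n - 1 > 0"
    using u one_less_power[of "2::nat" "2 * u"] by (simp add: n_def)
  have "(\<Sum>w\<in>row_ids. \<Sum>h\<in>plants. real (card {G \<in> seeds. coll h w (queried t (hidden_input h row_ids G))}))
      \<le> (\<Sum>w\<in>row_ids. \<Sum>h\<in>plants.
          real (card {G \<in> seeds. visits (row_coords w) t (hidden_input h row_ids G) > m})
          + real (card {G \<in> seeds. coll h w (queried (trunc (row_coords w) m t) (hidden_input h row_ids G))}))"
    by (intro sum_mono) (use card_coll_le in \<open>simp flip: of_nat_add\<close>)
  also have "\<dots> = (\<Sum>h\<in>plants. \<Sum>w\<in>row_ids. real (card {G \<in> seeds. visits (row_coords w) t (hidden_input h row_ids G) > m}))
      + (\<Sum>w\<in>row_ids. \<Sum>h\<in>plants. real (card {G \<in> seeds. coll h w (queried (trunc (row_coords w) m t) (hidden_input h row_ids G))}))"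
    by (simp only: sum.distrib sum.swap[of _ row_ids plants])
  also have "\<dots> \<le> (\<Sum>h\<in>plants. 2 ^ sheet * T / m)
      + (\<Sum>w\<in>row_ids. card plants * 2 ^ sheet * (m * 2 ^ u) / (n * (real n - 1)))"
  proof (intro add_mono sum_mono)
    fix h
    have "real ((\<Sum>w\<in>row_ids. card {G \<in> seeds. visits (row_coords w) t (hidden_input h row_ids G) > m}) * m) \<le> real (2 ^ sheet * T)"
      using sum_visits_gt[OF T] by (simp only: of_nat_le_iff)
    then show "(\<Sum>w\<in>row_ids. real (card {G \<in> seeds. visits (row_coords w) t (hidden_input h row_ids G) > m})) \<le> 2 ^ sheet * T / m"
      using m by (simp add: field_simps)
  next
    fix w assume "w \<in> row_ids"
    from sum_coll_trunc[OF this, of m t]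
    have "real ((\<Sum>h\<in>plants. card {G \<in> seeds. coll h w (queried (trunc (row_coords w) m t) (hidden_input h row_ids G))})
        * (n * (n - 1))) \<le> real (card plants * 2 ^ sheet * (m * 2 ^ u))"
      by (simp only: of_nat_le_iff)
    then show "(\<Sum>h\<in>plants. real (card {G \<in> seeds. coll h w (queried (trunc (row_coords w) m t) (hidden_input h row_ids G))}))
        \<le> card plants * 2 ^ sheet * (m * 2 ^ u) / (n * (real n - 1))"
      using n1 by (simp add: field_simps of_nat_diff)
  qed
  also have "\<dots> = real (card plants) * 2 ^ sheet * (T / m + c * n * (m * 2 ^ u) / (n * (real n - 1)))"
    by (simp add: algebra_simps add_divide_distrib)
  finally show ?thesis .
qed

section \<open>Visits to the addressed page\<close>

definition address :: "nat \<Rightarrow> nat set" where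
  "address b = {sheet + b * cells..<sheet + Suc b * cells}"

text \<open>One row is left unplanted in each block that is to encode 0. The same row number is used
  in all blocks, so the sets for different \<open>\<rho>\<close> are disjoint and averaging over
  \<open>\<rho>\<close> charges each row at most once.\<close>

definition removed :: "nat \<Rightarrow> nat \<Rightarrow> nat set" where
  "removed b \<rho> = {i * n + \<rho> | i. i < c \<and> \<not> bit b i}"

lemma removed_subset: "\<rho> < n \<Longrightarrow> removed b \<rho> \<subseteq> row_ids"
  unfolding removed_def using pair_index_less[of _ c \<rho> n] by auto

text \<open>The pages are disjoint, so choosing one queried coordinate in each visited page is
  injective.\<close>

lemma card_address_visited:
  assumes "dtree_depth t \<le> T"
  shows "card {b \<in> {..<B}. queried t X \<inter> address b \<noteq> {}} \<le> T"
proof -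
  have "disjoint_family address"
  proof -
    have "address a \<inter> address b = {}" if "a < b" for a b
    proof -
      have "Suc a * cells \<le> b * cells" using that by (intro mult_right_mono) auto
      then show ?thesis by (auto simp: address_def)
    qed
    then show ?thesis unfolding disjoint_family_on_def by (metis Int_commute linorder_neqE_nat)
  qed
  define S where "S = {b \<in> {..<B}. queried t X \<inter> address b \<noteq> {}}"
  define g where "g b = (SOME q. q \<in> queried t X \<inter> address b)" for b
  have g: "g b \<in> queried t X \<inter> address b" if "b \<in> S" for b
    unfolding g_def by (rule someI_ex) (use that in \<open>auto simp: S_def\<close>)
  have "inj_on g S"
  proof (rule inj_onI)
    fix a b assume ab: "a \<in> S" "b \<in> S" "g a = g b"
    then have "g a \<in> address a \<inter> address b" using g[of a] g[of b] by simp
    then show "a = b" using \<open>disjoint_family address\<close> unfolding disjoint_family_on_def by blast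
  qed
  then have "card S \<le> card (queried t X)"
    using g by (intro card_inj_on_le[of g]) auto
  then show ?thesis using card_queried[of t X] assms by (simp add: S_def)
qed

text \<open>Seeds are split by collisions in \<open>U\<close>; the collision-free counts agree with
  and without \<open>U\<close> planted. The two kinds of counts on the right refer to the fully
  planted input, which does not depend on \<open>U\<close>.\<close>

lemma card_address_le:
  assumes "U \<subseteq> row_ids"
  shows "card {G \<in> seeds. queried t (hidden_input h (row_ids - U) G) \<inter> address b \<noteq> {}} \<le>
    card {G \<in> seeds. queried t (hidden_input h row_ids G) \<inter> address b \<noteq> {}} +
    (\<Sum>w\<in>U. card {G \<in> seeds. coll h w (queried t (hidden_input h row_ids G))})"
proof -
  have finU: "finite U" using assms finite_subset by blast
  define Q where "Q V G = queried t (hidden_input h V G)" for V G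
  define good where "good A \<longleftrightarrow> (\<forall>w\<in>U. \<not> coll h w A)" for A
  have fin: "finite {G \<in> seeds. P G}" for P by (rule finite_subset[of _ seeds]) auto
  have "card {G \<in> seeds. Q (row_ids - U) G \<inter> address b \<noteq> {}}
      \<le> card ({G \<in> seeds. Q (row_ids - U) G \<inter> address b \<noteq> {} \<and> good (Q (row_ids - U) G)} \<union>
          {G \<in> seeds. \<not> good (Q (row_ids - U) G)})"
    by (intro card_mono finite_UnI fin) auto
  also have "\<dots> \<le> card {G \<in> seeds. Q (row_ids - U) G \<inter> address b \<noteq> {} \<and> good (Q (row_ids - U) G)} +
      card {G \<in> seeds. \<not> good (Q (row_ids - U) G)}"
    by (rule card_Un_le)
  also have "card {G \<in> seeds. Q (row_ids - U) G \<inter> address b \<noteq> {} \<and> good (Q (row_ids - U) G)} =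
      card {G \<in> seeds. Q row_ids G \<inter> address b \<noteq> {} \<and> good (Q row_ids G)}"
    unfolding Q_def using card_plants_same_kernel[of "\<lambda>A. A \<inter> address b \<noteq> {} \<and> good A" U h t row_ids]
    by (simp add: good_def)
  also have "card {G \<in> seeds. \<not> good (Q (row_ids - U) G)} = card {G \<in> seeds. \<not> good (Q row_ids G)}"
    unfolding card_seeds_not Q_def
    using card_plants_same_kernel[of good U h t row_ids] by (simp add: good_def)
  also have "card {G \<in> seeds. Q row_ids G \<inter> address b \<noteq> {} \<and> good (Q row_ids G)}
      \<le> card {G \<in> seeds. Q row_ids G \<inter> address b \<noteq> {}}"
    by (intro card_mono fin) auto
  also have "card {G \<in> seeds. \<not> good (Q row_ids G)} \<le> card (\<Union>w\<in>U. {G \<in> seeds. coll h w (Q row_ids G)})"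
    using finU fin by (intro card_mono) (auto simp: good_def)
  also have "\<dots> \<le> (\<Sum>w\<in>U. card {G \<in> seeds. coll h w (Q row_ids G)})"
    by (rule card_UN_le[OF finU])
  finally show ?thesis by (simp add: Q_def)
qed

lemma sum_removed_le:
  fixes g :: "nat \<Rightarrow> real"
  assumes "\<And>w. g w \<ge> 0"
  shows "(\<Sum>\<rho><n. \<Sum>w\<in>removed b \<rho>. g w) \<le> (\<Sum>w\<in>row_ids. g w)"
proof -
  have "(\<Sum>\<rho><n. \<Sum>w\<in>removed b \<rho>. g w) = (\<Sum>w\<in>(\<Union>\<rho><n. removed b \<rho>). g w)"
  proof (rule sum.UNION_disjoint[symmetric])
    show "\<forall>\<rho>\<in>{..<n}. finite (removed b \<rho>)"
      using removed_subset finite_subset by blast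
    have "w mod n = \<rho>" if "w \<in> removed b \<rho>" "\<rho> < n" for w \<rho>
      using that by (auto simp: removed_def)
    then show "\<forall>\<rho>\<in>{..<n}. \<forall>\<rho>'\<in>{..<n}. \<rho> \<noteq> \<rho>' \<longrightarrow> removed b \<rho> \<inter> removed b \<rho>' = {}"
      by blast
  qed simp
  also have "\<dots> \<le> (\<Sum>w\<in>row_ids. g w)"
    using removed_subset assms by (intro sum_mono2) auto
  finally show ?thesis .
qed

text \<open>The fully planted input carries no information on \<open>b\<close>, and at most
  \<open>T\<close> of the \<open>2 ^ c\<close> pages are visited. The other two terms are the
  collision bound divided by \<open>n\<close>, the gain from the random
  \<open>\<rho>\<close>.\<close>

lemma sum_address_visited:
  assumes T: "dtree_depth t \<le> T" and m: "m > 0" and u: "u > 0"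
  shows "(\<Sum>b<2 ^ c. \<Sum>\<rho><n. \<Sum>h\<in>plants.
      real (card {G \<in> seeds. queried t (hidden_input h (row_ids - removed b \<rho>) G) \<inter> address b \<noteq> {}}))
    \<le> 2 ^ c * n * real (card plants) * 2 ^ sheet *
      (T / 2 ^ c + T / (n * m) + c * (m * 2 ^ u) / (n * (real n - 1)))"
proof -
  define C where "C w = (\<Sum>h\<in>plants. real (card {G \<in> seeds. coll h w (queried t (hidden_input h row_ids G))}))" for w
  define V where "V b h = real (card {G \<in> seeds. queried t (hidden_input h row_ids G) \<inter> address b \<noteq> {}})" for b h
  define Z where "Z = real (card plants) * 2 ^ sheet"
  have "(\<Sum>b<2 ^ c. \<Sum>\<rho><n. \<Sum>h\<in>plants.
      real (card {G \<in> seeds. queried t (hidden_input h (row_ids - removed b \<rho>) G) \<inter> address b \<noteq> {}}))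
    \<le> (\<Sum>b<2 ^ c. \<Sum>\<rho><n. \<Sum>h\<in>plants. V b h +
        (\<Sum>w\<in>removed b \<rho>. real (card {G \<in> seeds. coll h w (queried t (hidden_input h row_ids G))})))"
    unfolding V_def
    by (intro sum_mono) (use card_address_le[OF removed_subset] in \<open>simp flip: of_nat_add of_nat_sum\<close>)
  also have "\<dots> = (\<Sum>b<2 ^ c. n * (\<Sum>h\<in>plants. V b h)) + (\<Sum>b<2 ^ c. \<Sum>\<rho><n. \<Sum>w\<in>removed b \<rho>. C w)"
  proof -
    have "(\<Sum>h\<in>plants. V b h + (\<Sum>w\<in>removed b \<rho>. real (card {G \<in> seeds. coll h w (queried t (hidden_input h row_ids G))})))
        = (\<Sum>h\<in>plants. V b h) + (\<Sum>w\<in>removed b \<rho>. C w)" for b \<rho>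
      unfolding C_def by (simp only: sum.distrib sum.swap[of _ plants "removed b \<rho>"])
    then show ?thesis by (simp only: sum.distrib sum_constant card_lessThan)
  qed
  also have "(\<Sum>b<2 ^ c. n * (\<Sum>h\<in>plants. V b h)) = n * (\<Sum>h\<in>plants. \<Sum>b<2 ^ c. V b h)"
    by (simp only: sum_distrib_left[symmetric] sum.swap[of _ "{..<2 ^ c}" plants])
  also have "\<dots> \<le> real n * (\<Sum>h\<in>plants. 2 ^ sheet * real T)"
  proof (intro mult_left_mono sum_mono)
    fix h
    have "(\<Sum>b<2 ^ c. card {G \<in> seeds. queried t (hidden_input h row_ids G) \<inter> address b \<noteq> {}}) =
        (\<Sum>G\<in>seeds. card {b \<in> {..<2 ^ c}. queried t (hidden_input h row_ids G) \<inter> address b \<noteq> {}})"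
      by (rule sum_card_swap) auto
    also have "\<dots> \<le> (\<Sum>G\<in>seeds. T)"
      by (intro sum_mono card_address_visited T)
    also have "\<dots> = 2 ^ sheet * T" by (simp add: card_Pow)
    finally have "real (\<Sum>b<2 ^ c. card {G \<in> seeds. queried t (hidden_input h row_ids G) \<inter> address b \<noteq> {}})
        \<le> real (2 ^ sheet * T)" by (simp only: of_nat_le_iff)
    then show "(\<Sum>b<2 ^ c. V b h) \<le> 2 ^ sheet * real T" by (simp add: V_def)
  qed simp
  also have "(\<Sum>b<2 ^ c. \<Sum>\<rho><n. \<Sum>w\<in>removed b \<rho>. C w) \<le> (\<Sum>b<(2 ^ c :: nat). \<Sum>w\<in>row_ids. C w)"
    by (intro sum_mono sum_removed_le) (simp add: C_def sum_nonneg)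
  also have "\<dots> = 2 ^ c * (\<Sum>w\<in>row_ids. C w)" by simp
  also have "(\<Sum>w\<in>row_ids. C w) \<le> Z * (T / m + c * n * (m * 2 ^ u) / (n * (real n - 1)))"
    unfolding C_def Z_def by (rule sum_coll[OF T m u])
  finally have "(\<Sum>b<2 ^ c. \<Sum>\<rho><n. \<Sum>h\<in>plants.
      real (card {G \<in> seeds. queried t (hidden_input h (row_ids - removed b \<rho>) G) \<inter> address b \<noteq> {}}))
    \<le> real n * (\<Sum>h\<in>plants. 2 ^ sheet * real T) + 2 ^ c * (Z * (T / m + c * n * (m * 2 ^ u) / (n * (real n - 1))))"
    by simp
  also have "\<dots> = 2 ^ c * n * Z * (T / 2 ^ c + T / (n * m) + c * (m * 2 ^ u) / (n * (real n - 1)))"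
    using m by (simp add: Z_def field_simps)
  finally show ?thesis by (simp add: Z_def mult.assoc)
qed

end

section \<open>Random cells are far from periodic\<close>

text \<open>An exponential moment of the number of disagreements. Each \<open>b y\<close> is a
  private fair coin: toggling it changes the comparison at \<open>y\<close> and no other, so every
  \<open>y\<close> contributes \<open>3 / 4\<close>, the mean of \<open>1 / 2\<close> and
  \<open>1\<close>.\<close>

lemma sum_weight_disagreement:
  fixes a b :: "'i \<Rightarrow> 'a"
  assumes "finite M" "finite Y"
    and "\<And>y. y \<in> Y \<Longrightarrow> b y \<in> M"
    and "\<And>y z. y \<in> Y \<Longrightarrow> z \<in> Y \<Longrightarrow> b y \<noteq> a z"
    and "inj_on b Y"
  shows "(\<Sum>G\<in>Pow M. \<Prod>y\<in>Y. if (a y \<in> G) \<noteq> (b y \<in> G) then 1 / 2 else 1) = (2 :: real) ^ card M * (3 / 4) ^ card Y"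
  using assms(2-5)
proof (induction Y rule: finite_induct)
  case empty
  show ?case using assms(1) by (simp add: card_Pow)
next
  case (insert y Y)
  define w where "w G y = (if (a y \<in> G) \<noteq> (b y \<in> G) then 1 / 2 else 1 :: real)" for G y
  define p where "p G = (\<Prod>z\<in>Y. w G z)" for G
  define v where "v = b y"
  define flip where "flip G = (if v \<in> G then G - {v} else insert v G)" for G
  have "bij_betw flip (Pow M) (Pow M)"
    by (rule bij_betwI[where g = flip]) (use insert.prems(1)[of y] in \<open>auto simp: flip_def v_def split: if_splits\<close>)
  from sum.reindex_bij_betw[OF this, of "\<lambda>G. w G y * p G"]
  have "(\<Sum>G\<in>Pow M. w G y * p G) = (\<Sum>G\<in>Pow M. w (flip G) y * p (flip G))" ..
  moreover have flip_p: "p (flip G) = p G" for G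
  proof -
    have "w (flip G) z = w G z" if "z \<in> Y" for z
    proof -
      have "a z \<noteq> v"
        using insert.prems(2)[of y z] that by (auto simp: v_def)
      moreover have "b z \<noteq> v"
        using inj_onD[OF insert.prems(3), of z y] insert.hyps that by (auto simp: v_def)
      ultimately show ?thesis by (simp add: w_def flip_def)
    qed
    then show ?thesis by (simp add: p_def)
  qed
  ultimately have "2 * (\<Sum>G\<in>Pow M. w G y * p G) = (\<Sum>G\<in>Pow M. w G y * p G) + (\<Sum>G\<in>Pow M. w (flip G) y * p G)"
    by simp
  also have "\<dots> = (\<Sum>G\<in>Pow M. (w G y + w (flip G) y) * p G)"
    by (simp only: sum.distrib distrib_right)
  also have "\<dots> = (\<Sum>G\<in>Pow M. 3 / 2 * p G)"
  proof -
    have "w G y + w (flip G) y = 3 / 2" for G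
      using insert.prems(2)[of y y] by (auto simp: w_def flip_def v_def)
    then show ?thesis by (simp only:)
  qed
  also have "(\<Sum>G\<in>Pow M. 3 / 2 * p G) = 3 / 2 * (2 ^ card M * (3 / 4) ^ card Y)"
  proof -
    have "(\<Sum>G\<in>Pow M. p G) = 2 ^ card M * (3 / 4) ^ card Y"
      unfolding p_def w_def using insert.prems by (intro insert.IH) auto
    then show ?thesis by (simp only: sum_distrib_left[symmetric])
  qed
  finally have "(\<Sum>G\<in>Pow M. w G y * p G) = 2 ^ card M * (3 / 4) ^ card (insert y Y)"
    using insert.hyps by simp
  then show ?case
    using insert.hyps by (simp add: w_def p_def)
qed

context cheat_sheet
begin

lemma card_lower_half:
  assumes "s \<in> {1..<n}"
  shows "2 * card {y. y < n \<and> y < y XOR s} = n"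
proof -
  let ?A = "{y. y < n \<and> y < y XOR s}" and ?B = "{y. y < n \<and> y XOR s < y}"
  have ne: "y XOR s \<noteq> y" for y
    using assms by (metis atLeastLessThan_iff not_one_le_zero xor_left_self xor_self_eq)
  have "bij_betw (\<lambda>y. y XOR s) ?A ?B"
    by (rule bij_betwI[where g = "\<lambda>y. y XOR s"]) (use assms xor_less_n in auto)
  then have "card ?A = card ?B" by (rule bij_betw_same_card)
  moreover have "?A \<union> ?B = {..<n}" using ne by (auto simp: neq_iff)
  moreover have "card (?A \<union> ?B) = card ?A + card ?B" by (rule card_Un_disjoint) auto
  ultimately show ?thesis by simp
qed

text \<open>A Chernoff bound with one comparison for each pair \<open>y\<close>,
  \<open>y XOR s\<close>. For \<open>n = 8 * k\<close> there are \<open>4 * k\<close> pairs of mean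
  weight \<open>(3 / 4) ^ (4 * k) = (81 / 256) ^ k\<close>. At most \<open>k\<close> disagreements
  force weight at least \<open>(1 / 2) ^ k\<close>, and
  \<open>2 * 81 / 256 = 81 / 128\<close>.\<close>

lemma card_few_disagreements:
  assumes e: "e < cells" and s: "s \<in> {1..<n}" and u: "u \<ge> 2"
  shows "card {G \<in> seeds. 8 * card {y. y < n \<and> (e * n + y \<in> G) \<noteq> (e * n + (y XOR s) \<in> G)} < n}
    \<le> 2 ^ sheet * (81 / 128) ^ (n div 8)"
proof -
  define k where "k = n div 8"
  have "n = 8 * 2 ^ (2 * u - 3)"
    using u power_add[of "2::nat" 3 "2 * u - 3"] by (simp add: n_def)
  then have k: "n = 8 * k" by (simp add: k_def)
  define Y where "Y = {y. y < n \<and> y < y XOR s}"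
  have cY: "card Y = 4 * k" using card_lower_half[OF s] k by (simp add: Y_def)
  define D where "D G = {y. y < n \<and> (e * n + y \<in> G) \<noteq> (e * n + (y XOR s) \<in> G)}" for G
  define w where "w G = (\<Prod>y\<in>Y. if (e * n + y \<in> G) \<noteq> (e * n + (y XOR s) \<in> G) then 1 / 2 else 1 :: real)" for G
  have wD: "w G = (1 / 2) ^ card (D G \<inter> Y)" for G
  proof -
    have "w G = (\<Prod>y\<in>Y. if y \<in> D G then 1 / 2 else 1)"
      unfolding w_def by (intro prod.cong) (auto simp: D_def Y_def)
    also have "\<dots> = (\<Prod>y\<in>Y \<inter> D G. 1 / 2)"
      by (intro prod.inter_restrict[symmetric]) (simp add: Y_def)
    finally show ?thesis by (simp add: Int_commute)
  qed
  have w: "w G \<ge> (1 / 2) ^ k" if "8 * card (D G) < n" for G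
  proof -
    have "card (D G \<inter> Y) \<le> card (D G)" by (intro card_mono) (auto simp: D_def)
    then have "card (D G \<inter> Y) \<le> k" using that k by simp
    then show ?thesis unfolding wD by (intro power_decreasing) auto
  qed
  have "(1 / 2) ^ k * card {G \<in> seeds. 8 * card (D G) < n} = (\<Sum>G\<in>{G \<in> seeds. 8 * card (D G) < n}. (1 / 2) ^ k)"
    by simp
  also have "\<dots> \<le> (\<Sum>G\<in>{G \<in> seeds. 8 * card (D G) < n}. w G)"
    using w by (intro sum_mono) auto
  also have "\<dots> \<le> (\<Sum>G\<in>seeds. w G)"
    by (intro sum_mono2) (auto simp: w_def intro!: prod_nonneg)
  also have "\<dots> = 2 ^ card {..<sheet} * (3 / 4) ^ card Y"
    unfolding w_def
  proof (rule sum_weight_disagreement)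
    show "e * n + (y XOR s) \<in> {..<sheet}" if "y \<in> Y" for y
      using that e s by (auto simp: Y_def intro!: cell_bit_less xor_less_n)
    show "e * n + (y XOR s) \<noteq> e * n + z" if "y \<in> Y" "z \<in> Y" for y z
    proof
      assume "e * n + (y XOR s) = e * n + z"
      then have "z = y XOR s" by simp
      then show False using that by (auto simp: Y_def)
    qed
    show "inj_on (\<lambda>y. e * n + (y XOR s)) Y"
      by (rule inj_onI) (metis add_left_cancel xor_right_self)
  qed (auto simp: Y_def)
  also have "\<dots> = 2 ^ sheet * (81 / 256) ^ k"
  proof -
    have "(3 / 4 :: real) ^ 4 = 81 / 256" by (simp add: power_divide)
    then show ?thesis by (simp only: cY power_mult card_lessThan)
  qed
  finally have le: "(1 / 2) ^ k * real (card {G \<in> seeds. 8 * card (D G) < n}) \<le> 2 ^ sheet * (81 / 256) ^ k" .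
  have "real (card {G \<in> seeds. 8 * card (D G) < n}) = 2 ^ k * ((1 / 2) ^ k * real (card {G \<in> seeds. 8 * card (D G) < n}))"
    by (simp add: power_divide)
  also have "\<dots> \<le> 2 ^ k * (2 ^ sheet * (81 / 256) ^ k)"
    using le by (intro mult_left_mono) auto
  also have "\<dots> = 2 ^ sheet * (2 * (81 / 256)) ^ k"
    by (simp only: power_mult_distrib mult.left_commute)
  finally show ?thesis by (simp add: D_def k_def)
qed

text \<open>Asked of all cells of the bare seed, so that the event involves none of
  \<open>b\<close>, \<open>\<rho>\<close>, \<open>h\<close>; it is applied to the cells of the
  unplanted rows.\<close>

definition generic :: "nat set \<Rightarrow> bool" where
  "generic G \<longleftrightarrow> (\<forall>e<cells. aperiodic n (cell (\<lambda>q. q \<in> G) e))"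

lemma card_not_generic:
  assumes u: "u \<ge> 2"
  shows "card {G \<in> seeds. \<not> generic G} \<le> 2 ^ sheet * (real cells * n * (81 / 128) ^ (n div 8))"
proof -
  define B where "B e s = {G \<in> seeds. 8 * card {y. y < n \<and> (e * n + y \<in> G) \<noteq> (e * n + (y XOR s) \<in> G)} < n}" for e s
  have "{G \<in> seeds. \<not> generic G} \<subseteq> (\<Union>e<cells. \<Union>s\<in>{1..<n}. B e s)"
    by (auto simp: generic_def aperiodic_def cell_def B_def not_le)
  then have "card {G \<in> seeds. \<not> generic G} \<le> card (\<Union>e<cells. \<Union>s\<in>{1..<n}. B e s)"
    by (intro card_mono) (auto simp: B_def)
  also have "\<dots> \<le> (\<Sum>e<cells. \<Sum>s\<in>{1..<n}. card (B e s))"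
    by (intro order_trans[OF card_UN_le] sum_mono) auto
  finally have "real (card {G \<in> seeds. \<not> generic G}) \<le> (\<Sum>e<cells. \<Sum>s\<in>{1..<n}. real (card (B e s)))"
    by (simp flip: of_nat_sum)
  also have "\<dots> \<le> (\<Sum>e<cells. \<Sum>s\<in>{1..<n}. 2 ^ sheet * (81 / 128) ^ (n div 8))"
    unfolding B_def using card_few_disagreements[OF _ _ u] by (intro sum_mono) auto
  also have "\<dots> = real cells * (real (n - 1) * (2 ^ sheet * (81 / 128) ^ (n div 8)))"
    by simp
  also have "\<dots> \<le> real cells * (real n * (2 ^ sheet * (81 / 128) ^ (n div 8)))"
    by (intro mult_left_mono mult_right_mono) auto
  also have "\<dots> = 2 ^ sheet * (real cells * n * (81 / 128) ^ (n div 8))"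
    by simp
  finally show ?thesis .
qed

section \<open>The randomized lower bound\<close>

text \<open>A cell number \<open>e\<close> decodes as block \<open>e div n div n\<close>, row
  \<open>e div n\<close> and column \<open>e mod n\<close>. The marked cells are the hidden ones
  where the digit is 1, and the unplanted row where it is 0.\<close>

definition certificate :: "nat \<Rightarrow> nat \<Rightarrow> (nat \<Rightarrow> nat \<times> nat) \<Rightarrow> nat set" where
  "certificate b \<rho> h = {e. e < cells \<and>
     (if bit b (e div n div n) then e mod n = fst (h (e div n)) else e div n mod n = \<rho>)}"

definition no_input :: "nat \<Rightarrow> nat \<Rightarrow> (nat \<Rightarrow> nat \<times> nat) \<Rightarrow> nat set \<Rightarrow> nat \<Rightarrow> bool" where
  "no_input b \<rho> h G = hidden_input h (row_ids - removed b \<rho>) G"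

text \<open>Seeds lie inside the sheet, so all pages of a no-input are blank; the yes-input differs
  from it on page \<open>b\<close> alone.\<close>

definition yes_input :: "nat \<Rightarrow> nat \<Rightarrow> (nat \<Rightarrow> nat \<times> nat) \<Rightarrow> nat set \<Rightarrow> nat \<Rightarrow> bool" where
  "yes_input b \<rho> h G q = (if q < sheet then no_input b \<rho> h G q
     else \<exists>e \<in> certificate b \<rho> h. q = sheet + b * cells + e)"

lemma cells_div: "e < cells \<longleftrightarrow> e div n div n < c"
  by (simp add: cells_def div_less_iff_less_mult)

lemma card_certificate: "card (certificate b \<rho> h) \<le> c * n"
proof -
  \<comment> \<open>Inside its block a marked cell is determined by one free coordinate: the row for
    digit 1, the column for digit 0.\<close>
  define g where "g e = e div n div n * n + (if bit b (e div n div n) then e div n mod n else e mod n)" for e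
  have gdiv: "g e div n = e div n div n" for e by (simp add: g_def)
  have "inj_on g (certificate b \<rho> h)"
  proof (rule inj_onI)
    fix e e' assume e: "e \<in> certificate b \<rho> h" "e' \<in> certificate b \<rho> h" "g e = g e'"
    then have i: "e div n div n = e' div n div n" using gdiv by metis
    then have "(if bit b (e div n div n) then e div n mod n = e' div n mod n else e mod n = e' mod n)"
      using e(3) by (simp add: g_def split: if_splits)
    then have "e div n = e' div n \<and> e mod n = e' mod n"
      using e(1,2) i by (auto simp: certificate_def split: if_splits) (metis div_mult_mod_eq)+
    then show "e = e'" by (metis div_mult_mod_eq)
  qed
  moreover have "g e < c * n" if "e \<in> certificate b \<rho> h" for e
    using that gdiv[of e] by (auto simp: certificate_def cells_div simp flip: div_less_iff_less_mult[OF n_pos])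
  ultimately have "card (certificate b \<rho> h) \<le> card {..<c * n}"
    by (intro card_inj_on_le[of g]) auto
  then show ?thesis by simp
qed

lemma marked_yes_input: "marked b (yes_input b \<rho> h G) = certificate b \<rho> h"
  by (auto simp: marked_def yes_input_def certificate_def)

lemma cell_index_div:
  assumes "r < n" "j < n"
  shows "((i * n + r) * n + j) div n = i * n + r" "((i * n + r) * n + j) mod n = j"
    "((i * n + r) * n + j) div n div n = i" "((i * n + r) * n + j) div n mod n = r"
  using assms by simp_all

lemma certified_yes_input:
  assumes h: "h \<in> plants" and \<rho>: "\<rho> < n" and G: "generic G"
  shows "certified b (yes_input b \<rho> h G)"
  unfolding certified_def marked_yes_input
proof (intro conjI allI impI)
  show "card (certificate b \<rho> h) \<le> c * n" by (rule card_certificate)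
next
  fix i assume i: "i < c"
  have cell_eq: "cell (yes_input b \<rho> h G) e y = (rep h (row_ids - removed b \<rho>) (e * n + y) \<in> G)"
    if "e < cells" "y < n" for e y
    using cell_bit_less[OF that] by (simp add: cell_def yes_input_def no_input_def)
  show "if bit b i
      then \<forall>r<n. \<exists>j<n. (i * n + r) * n + j \<in> certificate b \<rho> h \<and>
        periodic n (cell (yes_input b \<rho> h G) ((i * n + r) * n + j))
      else \<exists>r<n. \<forall>j<n. (i * n + r) * n + j \<in> certificate b \<rho> h \<and>
        aperiodic n (cell (yes_input b \<rho> h G) ((i * n + r) * n + j))"
  proof (cases "bit b i")
    case True
    have "\<exists>j<n. (i * n + r) * n + j \<in> certificate b \<rho> h \<and>
        periodic n (cell (yes_input b \<rho> h G) ((i * n + r) * n + j))" if r: "r < n" for r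
    proof -
      define w where "w = i * n + r"
      define j where "j = fst (h w)"
      define s where "s = snd (h w)"
      define e where "e = w * n + j"
      have w: "w \<in> row_ids" using pair_index_less[OF i r] by (simp add: w_def)
      have js: "j < n" "s \<in> {1..<n}"
        using PiE_mem[OF h w] by (auto simp: j_def s_def mem_Times_iff)
      have e: "e < cells" using cell_index_less[OF i r js(1)] by (simp add: e_def w_def)
      have "w \<notin> removed b \<rho>"
      proof
        assume "w \<in> removed b \<rho>"
        then obtain i' where i': "w = i' * n + \<rho>" "\<not> bit b i'" by (auto simp: removed_def)
        have "w div n = i" using r by (simp add: w_def)
        moreover have "w div n = i'" using \<rho> by (simp add: i'(1))
        ultimately show False using True i'(2) by simp
      qed
      \<comment> \<open>Both points of a pair are represented by their minimum, so the planted cell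
        has period \<open>s\<close> whatever \<open>G\<close> is.\<close>
      then have rep: "rep h (row_ids - removed b \<rho>) (e * n + y) = min (e * n + y) (e * n + (y XOR s))"
        if "y < n" for y
        using w js that xor_less_n by (simp add: rep_def shift_def e_def j_def s_def)
      have "cell (yes_input b \<rho> h G) e y = cell (yes_input b \<rho> h G) e (y XOR s)" if "y < n" for y
        using js that xor_less_n by (simp add: cell_eq e rep min.commute)
      then have "periodic n (cell (yes_input b \<rho> h G) e)"
        unfolding periodic_def using js by blast
      moreover have "e \<in> certificate b \<rho> h"
        using e js True r cell_index_div[of r j i] unfolding certificate_def e_def w_def[symmetric]
        by (simp add: w_def j_def)
      ultimately show ?thesis using js(1) by (auto simp: e_def w_def)
    qed
    then show ?thesis using True by simp
  next
    case False
    have "(i * n + \<rho>) * n + j \<in> certificate b \<rho> h \<and>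
        aperiodic n (cell (yes_input b \<rho> h G) ((i * n + \<rho>) * n + j))" if j: "j < n" for j
    proof -
      define e where "e = (i * n + \<rho>) * n + j"
      have e: "e < cells" unfolding e_def by (rule cell_index_less[OF i \<rho> j])
      have "e \<in> certificate b \<rho> h"
        using e False cell_index_div[OF \<rho> j, of i] by (simp add: certificate_def e_def)
      moreover have "cell (yes_input b \<rho> h G) e y = cell (\<lambda>q. q \<in> G) e y" if y: "y < n" for y
      proof -
        \<comment> \<open>The row is unplanted, so its cells are those of the generic seed.\<close>
        have "i * n + \<rho> \<in> removed b \<rho>" using i False by (auto simp: removed_def)
        then have "rep h (row_ids - removed b \<rho>) (e * n + y) = e * n + y"
          using y j by (simp add: rep_def e_def)
        then show ?thesis using cell_eq[OF e y] by (simp add: cell_def)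
      qed
      then have "{y. y < n \<and> cell (yes_input b \<rho> h G) e y \<noteq> cell (yes_input b \<rho> h G) e (y XOR s)} =
          {y. y < n \<and> cell (\<lambda>q. q \<in> G) e y \<noteq> cell (\<lambda>q. q \<in> G) e (y XOR s)}" if "s \<in> {1..<n}" for s
        using that xor_less_n by auto
      then have "aperiodic n (cell (yes_input b \<rho> h G) e)"
        using G e unfolding generic_def aperiodic_def by auto
      ultimately show ?thesis by (simp add: e_def)
    qed
    then show ?thesis using False \<rho> by auto
  qed
qed

text \<open>A witness for either digit requires a marked cell, and blank pages have none;
  \<open>c > 0\<close> provides a digit that needs a witness.\<close>

lemma not_certified_no_input:
  assumes "c > 0" "G \<in> seeds"
  shows "\<not> certified b' (no_input b \<rho> h G)"
proof
  assume cert: "certified b' (no_input b \<rho> h G)"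
  have "marked b' (no_input b \<rho> h G) = {}"
    using assms(2) rep_sheet by (fastforce simp: marked_def no_input_def)
  then show False
    using cert assms(1) unfolding certified_def by (auto split: if_splits) (metis n_pos)+
qed

lemma certified_list:
  assumes "b < 2 ^ c"
  shows "certified b ((!) (map X [0..<input_size])) \<longleftrightarrow> certified b X"
proof -
  have nth: "map X [0..<input_size] ! q = X q" if "q < input_size" for q using that by simp
  have "marked b ((!) (map X [0..<input_size])) = marked b X"
    unfolding marked_def using nth[OF sheet_bit_less[OF assms]] by auto
  then show ?thesis
  proof (rule certified_cong)
    fix e y assume "e \<in> marked b ((!) (map X [0..<input_size]))" "y < n"
    then have "e * n + y < sheet" by (auto simp: marked_def intro: cell_bit_less)
    then show "map X [0..<input_size] ! (e * n + y) = X (e * n + y)"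
      by (intro nth) (simp add: input_size_def)
  qed
qed

lemma run_yes_input:
  assumes "G \<in> seeds" "queried t (no_input b \<rho> h G) \<inter> address b = {}"
  shows "run t (yes_input b \<rho> h G) = run t (no_input b \<rho> h G)"
proof (rule run_cong[symmetric])
  fix q assume q: "q \<in> queried t (no_input b \<rho> h G)"
  then have "q \<notin> address b" using assms(2) by blast
  then have "\<not> (\<exists>e \<in> certificate b \<rho> h. q = sheet + b * cells + e)"
    by (auto simp: address_def certificate_def)
  moreover have "\<not> no_input b \<rho> h G q" if "\<not> q < sheet"
    using that assms(1) rep_sheet by (fastforce simp: no_input_def)
  ultimately show "no_input b \<rho> h G q = yes_input b \<rho> h G q"
    by (simp add: yes_input_def)
qed

end

text \<open>Reading all coordinates computes any \<open>g\<close>, so the \<open>LEAST\<close> in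
  \<open>R_query\<close> is attained. The induction goes from complete prefixes \<open>p\<close>
  back to the empty one.\<close>

lemma exists_dtree: "\<exists>t. valid_dtree N t \<and> (\<forall>x\<in>bool_cube N. dtree_eval t x = g x)"
proof -
  have "\<exists>t. valid_dtree N t \<and> (\<forall>x\<in>bool_cube N. take i x = p \<longrightarrow> dtree_eval t x = g x)"
    if "i \<le> N" for i p
    using that
  proof (induction i arbitrary: p rule: inc_induct)
    case base
    show ?case by (rule exI[of _ "Output (g p)"]) (auto simp: bool_cube_def)
  next
    case (step i)
    obtain l where l: "valid_dtree N l" "\<And>x. x \<in> bool_cube N \<Longrightarrow> take (Suc i) x = p @ [False] \<Longrightarrow> dtree_eval l x = g x"
      using step.IH by blast
    obtain r where r: "valid_dtree N r" "\<And>x. x \<in> bool_cube N \<Longrightarrow> take (Suc i) x = p @ [True] \<Longrightarrow> dtree_eval r x = g x"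
      using step.IH by blast
    have "dtree_eval (Query i l r) x = g x" if "x \<in> bool_cube N" "take i x = p" for x
      using that step.hyps l(2)[of x] r(2)[of x] take_Suc_conv_app_nth[of i x] by (auto simp: bool_cube_def)
    then show ?case using l(1) r(1) step.hyps by (intro exI[of _ "Query i l r"]) auto
  qed
  from this[of 0 "[]"] show ?thesis by simp
qed

lemma R_query_witness:
  "\<exists>P :: dtree pmf. (\<forall>t \<in> set_pmf P. valid_dtree N t \<and> dtree_depth t \<le> R_query N (bool_cube N) g) \<and>
     (\<forall>x \<in> bool_cube N. measure_pmf.prob P {t. dtree_eval t x = g x} \<ge> 2 / 3)"
proof -
  define Q where "Q k \<longleftrightarrow> (\<exists>P :: dtree pmf. (\<forall>t \<in> set_pmf P. valid_dtree N t \<and> dtree_depth t \<le> k) \<and>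
     (\<forall>x \<in> bool_cube N. measure_pmf.prob P {t. dtree_eval t x = g x} \<ge> 2 / 3))" for k
  obtain t where t: "valid_dtree N t" "\<forall>x\<in>bool_cube N. dtree_eval t x = g x"
    using exists_dtree by blast
  have "Q (dtree_depth t)"
    unfolding Q_def by (rule exI[of _ "return_pmf t"]) (simp add: t measure_return_pmf)
  then have "Q (LEAST k. Q k)" by (rule LeastI)
  then show ?thesis by (simp only: Q_def R_query_def)
qed

context cheat_sheet
begin

text \<open>The outputs on the two inputs can differ only if page \<open>b\<close> is visited on the
  no-input.\<close>

lemma sum_run_inputs:
  assumes T: "dtree_depth t \<le> T" and m: "m > 0" and u: "u > 0"
  defines "\<Omega> \<equiv> {..<2 ^ c} \<times> {..<n} \<times> plants \<times> seeds"
  shows "(\<Sum>(b, \<rho>, h, G)\<in>\<Omega>. of_bool (run t (yes_input b \<rho> h G)) - of_bool (run t (no_input b \<rho> h G)))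
    \<le> real (card \<Omega>) * (T / 2 ^ c + T / (n * m) + c * (m * 2 ^ u) / (n * (real n - 1)))"
proof -
  have "(\<Sum>(b, \<rho>, h, G)\<in>\<Omega>. of_bool (run t (yes_input b \<rho> h G)) - of_bool (run t (no_input b \<rho> h G)))
      \<le> (\<Sum>(b, \<rho>, h, G)\<in>\<Omega>. of_bool (queried t (no_input b \<rho> h G) \<inter> address b \<noteq> {}) :: real)"
    by (rule sum_mono) (auto simp: \<Omega>_def run_yes_input)
  also have "\<dots> = (\<Sum>b<2 ^ c. \<Sum>\<rho><n. \<Sum>h\<in>plants. \<Sum>G\<in>seeds. of_bool (queried t (no_input b \<rho> h G) \<inter> address b \<noteq> {}))"
    unfolding \<Omega>_def by (simp only: sum.cartesian_product)
  also have "\<dots> = (\<Sum>b<2 ^ c. \<Sum>\<rho><n. \<Sum>h\<in>plants.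
      real (card {G \<in> seeds. queried t (no_input b \<rho> h G) \<inter> address b \<noteq> {}}))"
    by (intro sum.cong refl) (simp add: of_bool_def sum.If_cases Int_def)
  also have "\<dots> \<le> 2 ^ c * n * real (card plants) * 2 ^ sheet *
      (T / 2 ^ c + T / (n * m) + c * (m * 2 ^ u) / (n * (real n - 1)))"
    unfolding no_input_def by (rule sum_address_visited[OF T m u])
  also have "2 ^ c * n * real (card plants) * 2 ^ sheet = real (card \<Omega>)"
    by (simp add: \<Omega>_def card_cartesian_product card_Pow)
  finally show ?thesis .
qed

text \<open>Averaging as in Yao's principle: correctness forces a mean acceptance gap of nearly
  \<open>1 / 3\<close> between yes-inputs and no-inputs, while every single tree of depth at most
  \<open>T\<close> has a mean gap of at most the first three terms of \<open>small\<close>.\<close>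

lemma R_query_gt:
  assumes m: "m > 0" and u: "u \<ge> 2" and c: "c > 0"
    and small: "T / 2 ^ c + T / (n * m) + c * (m * 2 ^ u) / (n * (real n - 1))
      + 2 / 3 * (real cells * n * (81 / 128) ^ (n div 8)) < 1 / 3"
  shows "R_query input_size (bool_cube input_size) target > T"
proof (rule ccontr)
  assume "\<not> ?thesis"
  then obtain P where P: "\<And>t. t \<in> set_pmf P \<Longrightarrow> valid_dtree input_size t \<and> dtree_depth t \<le> T"
    "\<And>x. x \<in> bool_cube input_size \<Longrightarrow> measure_pmf.prob P {t. dtree_eval t x = target x} \<ge> 2 / 3"
    using R_query_witness[of input_size target] by (meson le_trans not_le)
  define \<epsilon> where "\<epsilon> = T / 2 ^ c + T / (n * m) + c * (m * 2 ^ u) / (n * (real n - 1))"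
  define \<beta> where "\<beta> = real cells * n * (81 / 128) ^ (n div 8)"
  define \<Omega> where "\<Omega> = {..<2 ^ c :: nat} \<times> {..<n} \<times> plants \<times> seeds"
  have fin: "finite \<Omega>" using finite_plants by (simp add: \<Omega>_def)
  define A where "A = (\<lambda>(b, \<rho>, h, G). {t. run t (yes_input b \<rho> h G)})"
  define B where "B = (\<lambda>(b, \<rho>, h, G). {t. run t (no_input b \<rho> h G)})"
  have prob_run: "measure_pmf.prob P {t. dtree_eval t (map X [0..<input_size]) = z} = measure_pmf.prob P {t. run t X = z}" for X z
  proof -
    have "run t ((!) (map X [0..<input_size])) = run t X" if "t \<in> set_pmf P" for t
      using P(1)[OF that] by (intro run_cong_valid[of input_size]) auto
    then show ?thesis
      by (intro measure_pmf.finite_measure_eq_AE) (auto simp: AE_measure_pmf_iff dtree_eval_eq_run)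
  qed
  have cube: "map X [0..<input_size] \<in> bool_cube input_size" for X
    by (simp add: bool_cube_def)
  have int: "integrable (measure_pmf P) (indicator S :: dtree \<Rightarrow> real)" for S
    by (rule measure_pmf.integrable_const_bound[of _ 1]) (auto simp: indicator_def)
  have "(\<Sum>\<omega>\<in>\<Omega>. measure_pmf.prob P (A \<omega>) - measure_pmf.prob P (B \<omega>))
      = measure_pmf.expectation P (\<lambda>t. \<Sum>\<omega>\<in>\<Omega>. indicator (A \<omega>) t - indicator (B \<omega>) t)"
    by (simp add: Bochner_Integration.integral_sum Bochner_Integration.integral_diff int)
  also have "\<dots> \<le> real (card \<Omega>) * \<epsilon>"
  proof (rule measure_pmf.integral_le_const)
    show "integrable (measure_pmf P) (\<lambda>t. \<Sum>\<omega>\<in>\<Omega>. indicator (A \<omega>) t - indicator (B \<omega>) t :: real)"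
      by (intro Bochner_Integration.integrable_sum Bochner_Integration.integrable_diff int)
    have "(\<Sum>\<omega>\<in>\<Omega>. indicator (A \<omega>) t - indicator (B \<omega>) t :: real) =
        (\<Sum>(b, \<rho>, h, G)\<in>\<Omega>. of_bool (run t (yes_input b \<rho> h G)) - of_bool (run t (no_input b \<rho> h G)))" for t
      by (intro sum.cong) (auto simp: A_def B_def indicator_def)
    then show "AE t in measure_pmf P. (\<Sum>\<omega>\<in>\<Omega>. indicator (A \<omega>) t - indicator (B \<omega>) t) \<le> real (card \<Omega>) * \<epsilon>"
      using sum_run_inputs[OF _ m] P(1) u by (simp add: AE_measure_pmf_iff \<epsilon>_def \<Omega>_def)
  qed
  finally have up: "(\<Sum>\<omega>\<in>\<Omega>. measure_pmf.prob P (A \<omega>) - measure_pmf.prob P (B \<omega>)) \<le> real (card \<Omega>) * \<epsilon>" .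
  \<comment> \<open>If the seed is not generic, the yes-input need not be true; only the bound
    \<open>- 1 / 3\<close> remains, a loss of \<open>2 / 3\<close>.\<close>
  have low: "measure_pmf.prob P (A \<omega>) - measure_pmf.prob P (B \<omega>) \<ge> 1 / 3 - 2 / 3 * of_bool (\<not> generic (snd (snd (snd \<omega>))))"
    if "\<omega> \<in> \<Omega>" for \<omega>
  proof -
    obtain b \<rho> h G where \<omega>: "\<omega> = (b, \<rho>, h, G)" by (metis prod.exhaust)
    have in_\<Omega>: "b < 2 ^ c" "\<rho> < n" "h \<in> plants" "G \<in> seeds" using that by (auto simp: \<omega> \<Omega>_def)
    have "\<not> target (map (no_input b \<rho> h G) [0..<input_size])"
      using not_certified_no_input[OF c in_\<Omega>(4)] certified_list by (auto simp: target_def)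
    then have "measure_pmf.prob P {t. run t (no_input b \<rho> h G) = False} \<ge> 2 / 3"
      using P(2)[OF cube, of "no_input b \<rho> h G"] by (simp only: prob_run)
    moreover have "{t. run t (no_input b \<rho> h G) = False} = UNIV - B \<omega>" by (auto simp: B_def \<omega>)
    ultimately have B: "measure_pmf.prob P (B \<omega>) \<le> 1 / 3"
      using measure_pmf.prob_compl[of "B \<omega>" P] by simp
    show ?thesis
    proof (cases "generic G")
      case True
      have "target (map (yes_input b \<rho> h G) [0..<input_size])"
        using certified_yes_input[OF in_\<Omega>(3,2) True] certified_list in_\<Omega>(1) by (auto simp: target_def)
      then have "measure_pmf.prob P {t. run t (yes_input b \<rho> h G) = True} \<ge> 2 / 3"
        using P(2)[OF cube, of "yes_input b \<rho> h G"] by (simp only: prob_run)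
      then have "measure_pmf.prob P (A \<omega>) \<ge> 2 / 3" by (simp add: A_def \<omega>)
      moreover have "1 / 3 - 2 / 3 * of_bool (\<not> generic (snd (snd (snd \<omega>)))) = (1 / 3 :: real)"
        by (simp add: \<omega> True)
      ultimately show ?thesis using B by linarith
    next
      case False
      then have "1 / 3 - 2 / 3 * of_bool (\<not> generic (snd (snd (snd \<omega>)))) = (- 1 / 3 :: real)"
        by (simp add: \<omega>)
      then show ?thesis using B measure_nonneg[of "measure_pmf P" "A \<omega>"] by linarith
    qed
  qed
  have "(\<Sum>\<omega>\<in>\<Omega>. of_bool (\<not> generic (snd (snd (snd \<omega>)))))
      = (\<Sum>b<(2 ^ c :: nat). \<Sum>\<rho><n. \<Sum>h\<in>plants. \<Sum>G\<in>seeds. of_bool (\<not> generic G) :: real)"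
    unfolding \<Omega>_def by (simp only: sum.cartesian_product case_prod_unfold)
  also have "\<dots> = 2 ^ c * n * real (card plants) * real (card {G \<in> seeds. \<not> generic G})"
    by (simp add: of_bool_def sum.If_cases Int_def)
  also have "\<dots> \<le> 2 ^ c * n * real (card plants) * (2 ^ sheet * \<beta>)"
    unfolding \<beta>_def using card_not_generic[OF u] by (intro mult_left_mono) auto
  also have "\<dots> = real (card \<Omega>) * \<beta>"
    by (simp add: \<Omega>_def card_cartesian_product card_Pow)
  finally have bad: "(\<Sum>\<omega>\<in>\<Omega>. of_bool (\<not> generic (snd (snd (snd \<omega>))))) \<le> real (card \<Omega>) * \<beta>" .
  have "real (card \<Omega>) * (1 / 3) - 2 / 3 * (real (card \<Omega>) * \<beta>)
      \<le> real (card \<Omega>) * (1 / 3) - 2 / 3 * (\<Sum>\<omega>\<in>\<Omega>. of_bool (\<not> generic (snd (snd (snd \<omega>)))))"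
    using bad by simp
  also have "\<dots> = (\<Sum>\<omega>\<in>\<Omega>. 1 / 3 - 2 / 3 * of_bool (\<not> generic (snd (snd (snd \<omega>)))))"
    by (simp add: sum_subtractf sum_distrib_left)
  also have "\<dots> \<le> (\<Sum>\<omega>\<in>\<Omega>. measure_pmf.prob P (A \<omega>) - measure_pmf.prob P (B \<omega>))"
    by (intro sum_mono low)
  also have "\<dots> \<le> real (card \<Omega>) * \<epsilon>" by (rule up)
  finally have "real (card \<Omega>) * (1 / 3 - 2 / 3 * \<beta> - \<epsilon>) \<le> 0"
    by (simp add: algebra_simps)
  moreover have "1 / 3 - 2 / 3 * \<beta> - \<epsilon> > 0"
  proof -
    have "\<epsilon> + 2 / 3 * \<beta> < 1 / 3" using small by (simp only: \<epsilon>_def \<beta>_def)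
    then show ?thesis by linarith
  qed
  moreover have "card \<Omega> > 0"
  proof -
    have "n > 1" using u one_less_power[of "2::nat" "2 * u"] by (simp add: n_def)
    then have "plants \<noteq> {}" by (auto simp: PiE_eq_empty_iff)
    then have "\<Omega> \<noteq> {}" by (auto simp: \<Omega>_def lessThan_empty_iff)
    then show ?thesis using fin by (simp add: card_gt_0_iff)
  qed
  ultimately show False
    by (simp add: mult_le_0_iff)
qed

end

section \<open>The hybrid upper bound\<close>

lemma sum_div_2:
  fixes N :: nat
  shows "(\<Sum>z<2 * N. g (z div 2)) = 2 * (\<Sum>y<N. g y :: real)"
  by (induction N) auto

lemma sum_agreement:
  "(\<Sum>y<N. if f y = g y then 1 else -1) = real N - 2 * real (card {y. y < N \<and> f y \<noteq> g y})"
proof -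
  have "(\<Sum>y<N. if f y = g y then 1 else -1) = (\<Sum>y<N. 1 - 2 * of_bool (f y \<noteq> g y) :: real)"
    by (intro sum.cong) auto
  also have "\<dots> = real N - 2 * (\<Sum>y<N. of_bool (f y \<noteq> g y))"
    by (simp add: sum_subtractf sum_distrib_left)
  also have "(\<Sum>y<N. of_bool (f y \<noteq> g y)) = real (card {y. y < N \<and> f y \<noteq> g y})"
    by (simp add: of_bool_def sum.If_cases Int_def)
  finally show ?thesis .
qed

context cheat_sheet
begin

text \<open>The \<open>2 * u\<close> index bits of a cell and the answer bit, which is the lowest; a
  period \<open>s\<close> of the cell therefore appears as \<open>2 * s\<close>.\<close>

abbreviation "K \<equiv> Suc (2 * u)"

lemma two_power_K: "2 ^ K = 2 * n"
  by (simp add: n_def)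

definition sample :: "nat \<Rightarrow> bool list \<Rightarrow> nat pmf" where
  "sample e x = walsh_pmf K (\<lambda>z. x ! (e * n + z div 2))"

text \<open>The answer bit merely repeats every point twice, so the autocorrelation at
  \<open>2 * s\<close> is that of the cell at \<open>s\<close>.\<close>

lemma prob_sample:
  assumes "s < n"
  shows "measure_pmf.prob (sample e x) {v. walsh K v (2 * s) = 1} =
    1 - card {y. y < n \<and> cell ((!) x) e y \<noteq> cell ((!) x) e (y XOR s)} / n"
proof -
  define f where "f = cell ((!) x) e"
  have s: "2 * s < 2 ^ K" using assms by (simp only: two_power_K)
  have "(\<Sum>z<2 ^ K. if f (z div 2) = f ((z XOR (2 * s)) div 2) then 1 else -1 :: real)
      = (\<Sum>z<2 * n. if f (z div 2) = f (z div 2 XOR s) then 1 else -1)"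
    unfolding two_power_K by (simp add: xor_div_2)
  also have "\<dots> = 2 * (real n - 2 * real (card {y. y < n \<and> f y \<noteq> f (y XOR s)}))"
    by (subst sum_div_2[of "\<lambda>y. if f y = f (y XOR s) then 1 else -1"]) (simp only: sum_agreement)
  finally have "(\<Sum>z<2 ^ K. if f (z div 2) = f ((z XOR (2 * s)) div 2) then 1 else -1 :: real) / 2 ^ K
      = 1 - 2 * (card {y. y < n \<and> f y \<noteq> f (y XOR s)} / n)"
    by (simp add: two_power_K[of, symmetric] flip: power_Suc) (simp add: n_def field_simps)
  then show ?thesis
    using prob_walsh_pmf_eq_1[OF s, of "\<lambda>z. x ! (e * n + z div 2)"]
    by (simp add: sample_def f_def cell_def)
qed

text \<open>The search for a period compatible with all samples is classical postprocessing and
  costs no queries.\<close>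

definition test :: "nat \<Rightarrow> nat \<Rightarrow> bool list \<Rightarrow> bool pmf" where
  "test m e x = map_pmf (\<lambda>vs. \<exists>s\<in>{1..<n}. \<forall>v\<in>set vs. walsh K v (2 * s) = 1)
     (sequence_pmf (map (\<lambda>_. sample e x) [0..<m]))"

lemma implements_test:
  assumes "e < cells"
  shows "implements input_size m (test m e)"
proof -
  have "e * n + n \<le> sheet"
    using mult_right_mono[of "Suc e" cells n] assms by (simp add: sheet_def)
  then have "2 * (e * n) + 2 ^ K \<le> input_size * 2"
    unfolding two_power_K input_size_def by simp
  then have "implements input_size 1 (sample e)"
    unfolding sample_def by (intro implements_fourier_sampling) simp_all
  then have "implements input_size (length [0..<m] * 1) (\<lambda>x. sequence_pmf (map (\<lambda>_. sample e x) [0..<m]))"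
    by (intro implements_sequence[of _ _ _ "\<lambda>_. sample e"])
  then show ?thesis
    unfolding test_def by (intro implements_map) simp
qed

lemma prob_samples:
  "measure_pmf.prob (sequence_pmf (map (\<lambda>_. sample e x) [0..<m])) {vs. length vs = m \<and> (\<forall>v\<in>set vs. v \<in> A)}
    = measure_pmf.prob (sample e x) A ^ m"
proof -
  have "list_all2 (\<lambda>a v. v \<in> A) [0..<m] vs \<longleftrightarrow> length vs = m \<and> (\<forall>v\<in>set vs. v \<in> A)" for vs
    by (auto simp: list_all2_conv_all_nth all_set_conv_all_nth)
  then show ?thesis
    using prob_sequence_pmf[of "\<lambda>_. sample e x" "[0..<m]" "\<lambda>_. A"]
    by (simp add: map_replicate_const)
qed

lemma test_periodic:
  assumes "periodic n (cell ((!) x) e)"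
  shows "measure_pmf.prob (test m e x) {True} = 1"
proof -
  obtain s where s: "s \<in> {1..<n}" "\<forall>y<n. cell ((!) x) e y = cell ((!) x) e (y XOR s)"
    using assms unfolding periodic_def by blast
  have "{y. y < n \<and> cell ((!) x) e y \<noteq> cell ((!) x) e (y XOR s)} = {}" using s(2) by auto
  then have "measure_pmf.prob (sample e x) {v. walsh K v (2 * s) = 1} = 1"
    using prob_sample[of s e x] s(1) by simp
  then have "1 = measure_pmf.prob (sequence_pmf (map (\<lambda>_. sample e x) [0..<m]))
      {vs. length vs = m \<and> (\<forall>v\<in>set vs. v \<in> {v. walsh K v (2 * s) = 1})}"
    by (simp only: prob_samples power_one)
  also have "\<dots> \<le> measure_pmf.prob (test m e x) {True}"
    unfolding test_def measure_map_pmf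
  proof (rule measure_pmf.finite_measure_mono)
    show "{vs. length vs = m \<and> (\<forall>v\<in>set vs. v \<in> {v. walsh K v (2 * s) = 1})} \<subseteq>
        (\<lambda>vs. \<exists>s\<in>{1..<n}. \<forall>v\<in>set vs. walsh K v (2 * s) = 1) -` {True}"
      unfolding vimage_def mem_Collect_eq singleton_iff simp_thms using s(1) by blast
  qed simp
  finally show ?thesis by (intro antisym) auto
qed

text \<open>A fixed candidate survives one sample with probability at most \<open>7 / 8\<close>; the
  factor \<open>n\<close> is the union bound over the candidates.\<close>

lemma test_aperiodic:
  assumes "aperiodic n (cell ((!) x) e)"
  shows "measure_pmf.prob (test m e x) {True} \<le> n * (7 / 8) ^ m"
proof -
  define S where "S = sequence_pmf (map (\<lambda>_. sample e x) [0..<m])"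
  define B where "B s = {vs. length vs = m \<and> (\<forall>v\<in>set vs. v \<in> {v. walsh K v (2 * s) = 1})}" for s
  have p: "measure_pmf.prob S (B s) \<le> (7 / 8) ^ m" if s: "s \<in> {1..<n}" for s
  proof -
    have "n \<le> 8 * card {y. y < n \<and> cell ((!) x) e y \<noteq> cell ((!) x) e (y XOR s)}"
      using assms s unfolding aperiodic_def by blast
    then have "real n \<le> 8 * real (card {y. y < n \<and> cell ((!) x) e y \<noteq> cell ((!) x) e (y XOR s)})"
      by linarith
    then have "measure_pmf.prob (sample e x) {v. walsh K v (2 * s) = 1} \<le> 7 / 8"
      using s by (subst prob_sample) (auto simp: field_simps)
    then show ?thesis
      unfolding S_def B_def prob_samples by (intro power_mono) auto
  qed
  have "measure_pmf.prob (test m e x) {True} \<le> measure_pmf.prob S (\<Union>s\<in>{1..<n}. B s)"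
    unfolding test_def measure_map_pmf S_def
    by (intro measure_pmf.finite_measure_mono_AE)
      (auto simp: AE_measure_pmf_iff B_def dest!: length_sequence_pmf)
  also have "\<dots> \<le> (\<Sum>s\<in>{1..<n}. measure_pmf.prob S (B s))"
    by (intro measure_pmf.finite_measure_subadditive_finite) auto
  also have "\<dots> \<le> (\<Sum>s\<in>{1..<n}. (7 / 8) ^ m)"
    by (intro sum_mono p)
  also have "\<dots> \<le> n * (7 / 8) ^ m"
    by (simp add: mult_right_mono)
  finally show ?thesis .
qed

lemma not_periodic_and_aperiodic: "periodic n f \<Longrightarrow> \<not> aperiodic n f"
proof
  assume "periodic n f" "aperiodic n f"
  then obtain s where s: "s \<in> {1..<n}" "\<forall>y<n. f y = f (y XOR s)" "n \<le> 8 * card {y. y < n \<and> f y \<noteq> f (y XOR s)}"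
    unfolding periodic_def aperiodic_def by blast
  then have "{y. y < n \<and> f y \<noteq> f (y XOR s)} = {}" by auto
  then have "n \<le> 8 * 0" using s(3) by (simp only: card.empty)
  then show False using n_pos by linarith
qed

section \<open>The cheat sheet algorithm\<close>

definition address_of :: "bool list \<Rightarrow> nat" where
  "address_of ts = horner_sum of_bool 2 (map (\<lambda>i. \<forall>r<n. \<exists>j<n. ts ! ((i * n + r) * n + j)) [0..<c])"

lemma address_of_less: "address_of ts < 2 ^ c"
  unfolding address_of_def using horner_sum_of_bool_2_less[of "map _ [0..<c]"] by (simp add: length_map)

lemma bit_address_of:
  "i < c \<Longrightarrow> bit (address_of ts) i \<longleftrightarrow> (\<forall>r<n. \<exists>j<n. ts ! ((i * n + r) * n + j))"
  unfolding address_of_def by (simp add: bit_horner_sum_bit_iff)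

text \<open>Certification with the marks \<open>S\<close> already read, which splits the adaptive
  check into two programs. The cost of the second has to be bounded for every \<open>S\<close>, so
  sets that are too large are rejected without reading any cell.\<close>

definition verdict :: "nat \<Rightarrow> nat set \<Rightarrow> bool list \<Rightarrow> bool" where
  "verdict b S x \<longleftrightarrow> S \<subseteq> {..<cells} \<and> card S \<le> c * n \<and>
     certified b (\<lambda>q. if q < sheet then x ! q else \<exists>e\<in>S. q = sheet + b * cells + e)"

lemma verdict_marked: "verdict b (marked b ((!) x)) x \<longleftrightarrow> certified b ((!) x)"
proof -
  define X where "X = (\<lambda>q. if q < sheet then x ! q else \<exists>e\<in>marked b ((!) x). q = sheet + b * cells + e)"
  have "marked b X = marked b ((!) x)"
    by (auto simp: marked_def X_def)
  then have "certified b X \<longleftrightarrow> certified b ((!) x)"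
  proof (rule certified_cong)
    fix e y assume "e \<in> marked b X" "y < n"
    then have "e * n + y < sheet" by (auto simp: marked_def intro: cell_bit_less)
    then show "X (e * n + y) = x ! (e * n + y)" by (simp add: X_def)
  qed
  moreover have "marked b ((!) x) \<subseteq> {..<cells}" by (auto simp: marked_def)
  moreover have "card (marked b ((!) x)) \<le> c * n" if "certified b ((!) x)"
    using that by (simp add: certified_def)
  ultimately show ?thesis unfolding verdict_def X_def[symmetric] by blast
qed

lemma implements_verdict: "implements input_size cells (\<lambda>x. return_pmf (verdict b S x))"
proof (cases "S \<subseteq> {..<cells} \<and> card S \<le> c * n")
  case False
  then have "verdict b S x \<longleftrightarrow> False" for x
    unfolding verdict_def by blast
  then show ?thesis
    using implements_mono[OF implements_return, of cells input_size False] by simp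
next
  case True
  define ps where "ps = concat (map (\<lambda>e. map (\<lambda>y. e * n + y) [0..<n]) (sorted_list_of_set S))"
  have fin: "finite S" using True finite_subset by blast
  then have "set ps = (\<Union>e\<in>S. (\<lambda>y. e * n + y) ` {0..<n})"
    unfolding ps_def by simp
  then have set_ps: "i \<in> set ps \<longleftrightarrow> (\<exists>e\<in>S. \<exists>y<n. i = e * n + y)" for i
    by (simp only: UN_iff image_iff Bex_def atLeastLessThan_iff zero_le simp_thms)
  have "length ps = card S * n"
    by (simp add: ps_def length_concat comp_def sum_list_triv)
  then have len: "length ps \<le> cells" using True by (simp add: cells_def)
  have "implements input_size (length ps) (\<lambda>x. return_pmf (verdict b S x))"
  proof (rule implements_local)
    fix i assume "i \<in> set ps"
    then have "i < sheet" using True cell_bit_less by (auto simp: set_ps)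
    then show "i < input_size" by (simp add: input_size_def)
  next
    fix x y :: "bool list" assume eq: "\<And>i. i \<in> set ps \<Longrightarrow> x ! i = y ! i"
    define X where "X = (\<lambda>(x :: bool list) q. if q < sheet then x ! q else \<exists>e\<in>S. q = sheet + b * cells + e)"
    have marked: "marked b (X z) = S" for z
      using True by (auto simp: marked_def X_def)
    have "certified b (X x) \<longleftrightarrow> certified b (X y)"
    proof (rule certified_cong)
      fix e y' assume "e \<in> marked b (X x)" "y' < n"
      then have "e * n + y' \<in> set ps" by (auto simp: marked set_ps)
      then show "X x (e * n + y') = X y (e * n + y')" using eq by (simp add: X_def)
    qed (simp add: marked)
    then show "verdict b S x = verdict b S y"
      unfolding verdict_def X_def by blast
  qed
  then show ?thesis using len by (rule implements_mono)
qed

lemma implements_certified: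
  assumes "b < 2 ^ c"
  shows "implements input_size (cells + cells) (\<lambda>x. return_pmf (certified b ((!) x)))"
proof -
  define ps where "ps = map (\<lambda>e. sheet + b * cells + e) [0..<cells]"
  have "implements input_size (length ps) (\<lambda>x. return_pmf (marked b ((!) x)))"
  proof (rule implements_local)
    show "i < input_size" if "i \<in> set ps" for i
      using that unfolding ps_def set_map by (elim imageE) (simp add: sheet_bit_less[OF assms])
    show "marked b ((!) x) = marked b ((!) y)" if "\<And>i. i \<in> set ps \<Longrightarrow> x ! i = y ! i" for x y :: "bool list"
      using that by (auto simp: marked_def ps_def)
  qed
  then have "implements input_size (cells + cells)
      (\<lambda>x. bind_pmf (return_pmf (marked b ((!) x))) (\<lambda>S. return_pmf (verdict b S x)))"
    by (intro implements_bind implements_verdict) (simp add: ps_def)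
  then show ?thesis by (simp add: bind_return_pmf verdict_marked)
qed

definition algorithm :: "nat \<Rightarrow> bool list \<Rightarrow> bool pmf" where
  "algorithm m x = bind_pmf (sequence_pmf (map (\<lambda>e. test m e x) [0..<cells]))
     (\<lambda>ts. return_pmf (certified (address_of ts) ((!) x)))"

lemma implements_algorithm: "implements input_size (cells * m + (cells + cells)) (algorithm m)"
  unfolding algorithm_def
proof (rule implements_bind)
  show "implements input_size (cells * m) (\<lambda>x. sequence_pmf (map (\<lambda>e. test m e x) [0..<cells]))"
    using implements_sequence[of "[0..<cells]" input_size m "test m"] implements_test by simp
qed (rule implements_certified[OF address_of_less])

text \<open>The error is one-sided: on a false input no page is certified, so every address leads to
  rejection. On a true input the cells in the certificate satisfy the promise, and correct tests on
  them fix all digits of the address.\<close>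

lemma algorithm_correct:
  assumes small: "real cells * (n * (7 / 8) ^ m) \<le> 1 / 3"
  shows "pmf (algorithm m x) (target x) \<ge> 2 / 3"
proof (cases "target x")
  case False
  then have "\<not> certified (address_of ts) ((!) x)" for ts
    using address_of_less by (auto simp: target_def)
  then have "algorithm m x = return_pmf False"
    by (simp add: algorithm_def)
  then show ?thesis using False by simp
next
  case True
  then obtain b where b: "b < 2 ^ c" "certified b ((!) x)" by (auto simp: target_def)
  define S where "S = sequence_pmf (map (\<lambda>e. test m e x) [0..<cells])"
  \<comment> \<open>On cells that are neither periodic nor aperiodic both answers are
    allowed.\<close>
  define A where "A e = {a. (periodic n (cell ((!) x) e) \<longrightarrow> a) \<and> (aperiodic n (cell ((!) x) e) \<longrightarrow> \<not> a)}" for e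
  define \<eta> where "\<eta> = n * (7 / 8 :: real) ^ m"
  have \<eta>: "\<eta> \<ge> 0" by (simp add: \<eta>_def)
  have pA: "measure_pmf.prob (test m e x) (A e) \<ge> 1 - \<eta>" for e
  proof (cases "periodic n (cell ((!) x) e)")
    case True
    then have "A e = {True}" using not_periodic_and_aperiodic by (auto simp: A_def)
    then show ?thesis using test_periodic[OF True] \<eta> by simp
  next
    case np: False
    show ?thesis
    proof (cases "aperiodic n (cell ((!) x) e)")
      case True
      have "A e = UNIV - {True}" using np True by (auto simp: A_def)
      then have "measure_pmf.prob (test m e x) (A e) = 1 - measure_pmf.prob (test m e x) {True}"
        using measure_pmf.prob_compl[of "{True}" "test m e x"] by simp
      then show ?thesis using test_aperiodic[OF True, of m] by (simp add: \<eta>_def)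
    next
      case False
      then have "A e = UNIV" using np by (auto simp: A_def)
      then show ?thesis using \<eta> by simp
    qed
  qed
  have prod: "1 - length es * \<eta> \<le> (\<Prod>e\<leftarrow>es. measure_pmf.prob (test m e x) (A e))" for es
  proof (induction es)
    case (Cons e es)
    define p where "p = measure_pmf.prob (test m e x) (A e)"
    define q where "q = (\<Prod>e\<leftarrow>es. measure_pmf.prob (test m e x) (A e))"
    have q: "q \<le> 1" unfolding q_def prob_sequence_pmf[symmetric] by (rule measure_pmf.prob_le_1)
    have p: "p \<le> 1" "1 - p \<le> \<eta>" using pA[of e] by (auto simp: p_def)
    have "(1 - p) * (1 - q) \<ge> 0" using p q by simp
    then have "p * q \<ge> p + q - 1" by (simp add: algebra_simps)
    moreover have "q \<ge> 1 - length es * \<eta>" using Cons by (simp add: q_def)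
    ultimately have "p * q \<ge> 1 - length (e # es) * \<eta>" using p by (simp add: algebra_simps)
    then show ?case by (simp add: p_def q_def)
  qed simp
  have "certified (address_of ts) ((!) x)" if ts: "list_all2 (\<lambda>e a. a \<in> A e) [0..<cells] ts" for ts
  proof -
    have A: "ts ! e \<in> A e" if "e < cells" for e
      using ts that by (auto simp: list_all2_conv_all_nth)
    have "bit (address_of ts) i \<longleftrightarrow> bit b i" if i: "i < c" for i
    proof (cases "bit b i")
      case True
      then have "\<forall>r<n. \<exists>j<n. (i * n + r) * n + j \<in> marked b ((!) x) \<and> periodic n (cell ((!) x) ((i * n + r) * n + j))"
        using conjunct2[OF b(2)[unfolded certified_def], rule_format, OF i] by simp
      then have "\<forall>r<n. \<exists>j<n. ts ! ((i * n + r) * n + j)"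
        using A[OF cell_index_less[OF i]] unfolding A_def by blast
      then show ?thesis using True bit_address_of[OF i] by simp
    next
      case False
      then have "\<exists>r<n. \<forall>j<n. (i * n + r) * n + j \<in> marked b ((!) x) \<and> aperiodic n (cell ((!) x) ((i * n + r) * n + j))"
        using conjunct2[OF b(2)[unfolded certified_def], rule_format, OF i] by simp
      then obtain r where "r < n" "\<forall>j<n. aperiodic n (cell ((!) x) ((i * n + r) * n + j))"
        by blast
      \<comment> \<open>One row of negative answers settles the digit, whatever the tests return in
        the rest of the block.\<close>
      then have "\<forall>j<n. \<not> ts ! ((i * n + r) * n + j)"
        using A[OF cell_index_less[OF i]] unfolding A_def by blast
      then show ?thesis using False bit_address_of[OF i] \<open>r < n\<close> by blast
    qed
    moreover have "\<not> bit (address_of ts) i" "\<not> bit b i" if "\<not> i < c" for i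
      using that bit_less_two_power b(1) address_of_less by blast+
    ultimately have "address_of ts = b" by (metis bit_eqI)
    then show ?thesis using b(2) by simp
  qed
  then have "measure_pmf.prob S {ts. list_all2 (\<lambda>e a. a \<in> A e) [0..<cells] ts}
      \<le> measure_pmf.prob S {ts. certified (address_of ts) ((!) x)}"
    by (intro measure_pmf.finite_measure_mono) auto
  moreover have "pmf (algorithm m x) True = measure_pmf.prob S {ts. certified (address_of ts) ((!) x)}"
    unfolding algorithm_def S_def[symmetric] map_pmf_def[symmetric] pmf_map by (simp add: vimage_def)
  moreover have "measure_pmf.prob S {ts. list_all2 (\<lambda>e a. a \<in> A e) [0..<cells] ts} \<ge> 1 - cells * \<eta>"
    unfolding S_def using prod[of "[0..<cells]"] by (simp add: prob_sequence_pmf)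
  ultimately show ?thesis using small True by (simp add: \<eta>_def)
qed

lemma H_query_target_le:
  assumes "c > 0" "real cells * (n * (7 / 8) ^ m) \<le> 1 / 3"
  shows "H_query 1 input_size (bool_cube input_size) target \<le> cells * (m + 2)"
proof -
  have "cells > 0" using assms(1) by (simp add: cells_def)
  then have "input_size > 0" by (simp add: input_size_def)
  then show ?thesis
    using H_query_le[OF _ implements_algorithm algorithm_correct] assms(2)
    by (metis add_mult_distrib2 mult_2_right)
qed

end

section \<open>Asymptotics\<close>

context cheat_sheet
begin

lemma n_eq: "real n = 4 ^ u"
  by (simp add: n_def power_mult)

lemma R_query_lower_bound:
  assumes c: "c = 6 * u" and u: "u \<ge> 2"
    and generic: "1 / 5 + 1 / 2 ^ u + 2 / 3 * (6 * real u * 64 ^ u * (81 / 128) powr (4 ^ u / 8)) < 1 / 3"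
    and large: "8 ^ u / (240 * real u) \<le> 8 ^ u / (120 * real u) - 1"
  shows "32 ^ u / (2400 * real u) \<le> R_query input_size (bool_cube input_size) target"
proof -
  \<comment> \<open>A row withstands about \<open>n * 2 ^ u = 8 ^ u\<close> queries. With
    \<open>c = 6 * u\<close> and \<open>n \<le> 2 * (n - 1)\<close>, the divisor
    \<open>120 * u\<close> brings the third error term to at most \<open>1 / 10\<close>; rounding
    down loses at most a factor 2 by \<open>large\<close>.\<close>
  define m where "m = nat \<lfloor>8 ^ u / (120 * real u)\<rfloor>"
  define T where "T = n * m div 10"
  have "real m = \<lfloor>8 ^ u / (120 * real u)\<rfloor>" by (simp add: m_def)
  then have m_le: "real m \<le> 8 ^ u / (120 * real u)" and m_ge: "8 ^ u / (240 * real u) \<le> real m"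
    using large by linarith+
  moreover have "8 ^ u / (240 * real u) > 0" using u by simp
  ultimately have m: "m > 0" by (metis less_le_trans of_nat_0_less_iff)
  have T: "real T \<le> real n * real m / 10"
  proof -
    have "real T \<le> real (n * m) / real 10" unfolding T_def by (rule of_nat_div_le_of_nat)
    then show ?thesis by simp
  qed
  have n2: "real n \<ge> 2"
    using u power_increasing[of 1 u "4::real"] by (simp add: n_eq)
  have "real m * (120 * real u) \<le> 8 ^ u" using m_le u by (simp add: field_simps)
  moreover have "real m * 1 \<le> real m * (120 * real u)" using u by (intro mult_left_mono) auto
  ultimately have m8: "real m \<le> 8 ^ u" by linarith
  \<comment> \<open>Here \<open>T\<close> is at most \<open>32 ^ u\<close>, against
    \<open>2 ^ c = 64 ^ u\<close> pages.\<close>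
  have e1: "T / 2 ^ c \<le> 1 / 2 ^ u"
  proof -
    have "real T \<le> real n * real m" using T by simp
    also have "\<dots> \<le> 4 ^ u * 8 ^ u" using m8 by (simp add: n_eq)
    also have "\<dots> = 32 ^ u" by (simp add: power_mult_distrib[symmetric])
    finally have "real T / 2 ^ c \<le> 32 ^ u / 2 ^ c" by (intro divide_right_mono) auto
    also have "(32::real) ^ u / 2 ^ c = 32 ^ u / (32 ^ u * 2 ^ u)"
      by (simp add: c power_mult power_mult_distrib[symmetric])
    also have "\<dots> = 1 / 2 ^ u" by simp
    finally show ?thesis .
  qed
  have e2: "T / (n * m) \<le> 1 / 10"
    using T m n2 by (simp add: field_simps)
  have e3: "c * (m * 2 ^ u) / (n * (real n - 1)) \<le> 1 / 10"
  proof -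
    have "c * (real m * 2 ^ u) = 6 * (real m * real u) * 2 ^ u" by (simp add: c)
    also have "\<dots> \<le> 6 * (8 ^ u / 120) * 2 ^ u"
      using \<open>real m * (120 * real u) \<le> 8 ^ u\<close> by (intro mult_right_mono mult_left_mono) (simp_all add: field_simps)
    also have "\<dots> = (4 ^ u * 4 ^ u) / 20"
      by (simp add: power_mult_distrib[symmetric])
    also have "\<dots> = real n * real n / 20" by (simp add: n_eq)
    also have "\<dots> \<le> real n * (2 * (real n - 1)) / 20"
      using n2 by (intro divide_right_mono mult_left_mono) auto
    finally have "c * (real m * 2 ^ u) \<le> 1 / 10 * (real n * (real n - 1))" by (simp add: algebra_simps)
    then show ?thesis using n2 by (simp add: pos_divide_le_eq)
  qed
  have e4: "real cells * n * (81 / 128) ^ (n div 8) = 6 * real u * 64 ^ u * (81 / 128) powr (4 ^ u / 8)"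
  proof -
    have "n = 8 * 2 ^ (2 * u - 3)"
      using u power_add[of "2::nat" 3 "2 * u - 3"] by (simp add: n_def)
    then have "n = 8 * (n div 8)" by simp
    then have "real n = 8 * real (n div 8)" by (metis of_nat_mult of_nat_numeral)
    then have n8: "real (n div 8) = 4 ^ u / 8" by (simp add: n_eq)
    have "(81 / 128 :: real) ^ (n div 8) = (81 / 128) powr real (n div 8)"
      by (rule powr_realpow[symmetric]) simp
    then have "(81 / 128 :: real) ^ (n div 8) = (81 / 128) powr (4 ^ u / 8)"
      by (simp only: n8)
    moreover have "real cells * n = 6 * real u * (4 ^ u * 4 ^ u * 4 ^ u)"
      unfolding cells_def by (simp add: c n_eq)
    ultimately show ?thesis
      by (simp add: power_mult_distrib[symmetric])
  qed
  have "R_query input_size (bool_cube input_size) target > T"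
  proof (rule R_query_gt[OF m u])
    show "c > 0" using u c by simp
    show "T / 2 ^ c + T / (n * m) + c * (m * 2 ^ u) / (n * (real n - 1))
      + 2 / 3 * (real cells * n * (81 / 128) ^ (n div 8)) < 1 / 3"
      using e1 e2 e3 generic unfolding e4 by linarith
  qed
  then have "T + 1 \<le> R_query input_size (bool_cube input_size) target" by simp
  then have "10 * (T + 1) \<le> 10 * R_query input_size (bool_cube input_size) target"
    by (rule mult_le_mono2)
  moreover have "n * m \<le> 10 * (T + 1)" unfolding T_def by presburger
  ultimately have "n * m \<le> 10 * R_query input_size (bool_cube input_size) target"
    by (rule order_trans[rotated])
  then have "real n * real m \<le> 10 * real (R_query input_size (bool_cube input_size) target)"
    by (metis of_nat_le_iff of_nat_mult of_nat_numeral)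
  moreover have "real n * (8 ^ u / (240 * real u)) \<le> real n * real m"
    using m_ge by (intro mult_left_mono) auto
  moreover have "real n * (8 ^ u / (240 * real u)) = 10 * (32 ^ u / (2400 * real u))"
    by (simp add: n_eq power_mult_distrib[symmetric])
  ultimately show ?thesis by linarith
qed

text \<open>Since \<open>(7 / 8) ^ 60\<close> is below \<open>1 / 128\<close>, taking
  \<open>60 * u\<close> samples per cell beats the factor \<open>n ^ 3 = 64 ^ u\<close> of the union
  bound. The cost is \<open>6 * u * n * n\<close> cells times at most \<open>62 * u\<close> queries,
  and \<open>6 * 62 = 372\<close>.\<close>

lemma H_query_upper_bound:
  assumes c: "c = 6 * u" and u: "u > 0"
    and error: "6 * real u * 64 ^ u * (7 / 8) ^ (60 * u) \<le> 1 / 3"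
  shows "H_query 1 input_size (bool_cube input_size) target \<le> 372 * real u ^ 2 * 16 ^ u"
proof -
  have "real cells * (n * (7 / 8) ^ (60 * u)) = 6 * real u * (4 ^ u * 4 ^ u * 4 ^ u) * (7 / 8) ^ (60 * u)"
    unfolding cells_def by (simp add: c n_eq)
  also have "\<dots> = 6 * real u * 64 ^ u * (7 / 8) ^ (60 * u)"
    by (simp only: power_mult_distrib[symmetric]) simp
  finally have "real cells * (n * (7 / 8) ^ (60 * u)) = 6 * real u * 64 ^ u * (7 / 8) ^ (60 * u)" .
  then have "real cells * (n * (7 / 8) ^ (60 * u)) \<le> 1 / 3" using error by (simp only:)
  then have "H_query 1 input_size (bool_cube input_size) target \<le> cells * (60 * u + 2)"
    using u c by (intro H_query_target_le) auto
  then have "real (H_query 1 input_size (bool_cube input_size) target) \<le> real (cells * (60 * u + 2))"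
    by (simp only: of_nat_le_iff)
  also have "\<dots> \<le> real (cells * (62 * u))"
    using u by (intro of_nat_mono mult_left_mono) auto
  also have "\<dots> = 372 * real u ^ 2 * (4 ^ u * 4 ^ u)"
    unfolding cells_def by (simp add: c n_eq power2_eq_square)
  also have "\<dots> = 372 * real u ^ 2 * 16 ^ u"
    by (simp only: power_mult_distrib[symmetric]) simp
  finally show ?thesis .
qed

end

theorem theorem1:
  shows "\<exists>(N :: nat \<Rightarrow> nat) (f :: nat \<Rightarrow> bool list \<Rightarrow> bool).
    strict_mono N \<and>
    filterlim (\<lambda>k. R_query (N k) (bool_cube (N k)) (f k)) at_top sequentially \<and>
    (\<lambda>k. real (H_query 1 (N k) (bool_cube (N k)) (f k)))
      \<in> soft_bigo (\<lambda>k. real (R_query (N k) (bool_cube (N k)) (f k)) powr (4 / 5))"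
proof -
  define N where "N k = cheat_sheet.input_size k (6 * k)" for k
  define f where "f k = cheat_sheet.target k (6 * k)" for k
  define R where "R k = R_query (N k) (bool_cube (N k)) (f k)" for k
  define H where "H k = H_query 1 (N k) (bool_cube (N k)) (f k)" for k

  have N_eq: "N k = 6 * k * (2 ^ (2 * k) * 2 ^ (2 * k)) * (2 ^ (2 * k) + 2 ^ (6 * k))" for k
    by (simp add: N_def cheat_sheet.input_size_def cheat_sheet.sheet_def cheat_sheet.cells_def
        cheat_sheet.n_def algebra_simps)
  have "strict_mono N"
    unfolding strict_mono_Suc_iff
  proof
    fix k
    have "N k \<le> 6 * k * (2 ^ (2 * Suc k) * 2 ^ (2 * Suc k)) * (2 ^ (2 * Suc k) + 2 ^ (6 * Suc k))"
      unfolding N_eq by (intro mult_mono add_mono power_increasing) auto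
    also have "\<dots> < N (Suc k)"
      unfolding N_eq by (intro mult_strict_right_mono) auto
    finally show "N k < N (Suc k)" .
  qed

  have lower: "\<forall>\<^sub>F k in sequentially. 32 ^ k / (2400 * real k) \<le> real (R k)"
  proof -
    have "\<forall>\<^sub>F k in sequentially. 1 / 5 + 1 / 2 ^ k + 2 / 3 * (6 * real k * 64 ^ k * (81 / 128) powr (4 ^ k / 8)) < 1 / 3"
      by real_asymp
    moreover have "\<forall>\<^sub>F k in sequentially. 8 ^ k / (240 * real k) \<le> 8 ^ k / (120 * real k) - 1"
      by real_asymp
    ultimately show ?thesis
      using eventually_ge_at_top[of 2]
    proof eventually_elim
      case (elim k)
      then show ?case
        unfolding R_def N_def f_def by (intro cheat_sheet.R_query_lower_bound) auto
    qed
  qed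
  have upper: "\<forall>\<^sub>F k in sequentially. real (H k) \<le> 372 * real k ^ 2 * 16 ^ k"
  proof -
    have "\<forall>\<^sub>F k in sequentially. 6 * real k * (1 / 2) ^ k \<le> 1 / 3"
      by real_asymp
    then have "\<forall>\<^sub>F k in sequentially. 6 * real k * 64 ^ k * (7 / 8) ^ (60 * k) \<le> 1 / 3"
    proof eventually_elim
      case (elim k)
      have "((7 / 8) ^ 60) ^ k \<le> (1 / 128 :: real) ^ k"
        by (intro power_mono) (simp_all add: power_divide)
      then have "6 * real k * 64 ^ k * (7 / 8) ^ (60 * k) \<le> 6 * real k * 64 ^ k * (1 / 128) ^ k"
        unfolding power_mult by (intro mult_left_mono) auto
      also have "\<dots> = 6 * real k * (64 * (1 / 128)) ^ k"
        by (simp only: power_mult_distrib mult.assoc)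
      finally show ?case using elim by simp
    qed
    then show ?thesis
      using eventually_gt_at_top[of 0]
    proof eventually_elim
      case (elim k)
      then show ?case
        unfolding H_def N_def f_def by (intro cheat_sheet.H_query_upper_bound) auto
    qed
  qed

  have "filterlim (\<lambda>k. 32 ^ k / (2400 * real k)) at_top sequentially"
    by real_asymp
  then have "filterlim (\<lambda>k. real (R k)) at_top sequentially"
    by (rule filterlim_at_top_mono) (rule lower)
  then have R_top: "filterlim R at_top sequentially"
    unfolding filterlim_at_top by (metis (mono_tags, lifting) eventually_mono of_nat_le_iff)

  \<comment> \<open>Two of the three logarithms come from \<open>H\<close>, one for the copies and
    one for the samples; the third pays for the factor \<open>1 / k\<close> in the lower bound on
    \<open>R\<close>.\<close>
  have "(\<lambda>k. real (H k)) \<in> O(\<lambda>k. real (R k) powr (4 / 5) * ln (real (R k) powr (4 / 5)) ^ 3)"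
  proof (rule bigoI)
    have "\<forall>\<^sub>F k in sequentially. 2400 * real k \<le> 4 ^ k"
      by real_asymp
    with lower upper eventually_gt_at_top[of 0]
    show "\<forall>\<^sub>F k in sequentially. norm (real (H k)) \<le>
        892800 * norm (real (R k) powr (4 / 5) * ln (real (R k) powr (4 / 5)) ^ 3)"
    proof eventually_elim
      case (elim k)
      define x where "x = real (R k) powr (4 / 5)"
      have k: "2400 * real k \<ge> 1" using elim by simp
      have p16: "16 ^ k = ((32 :: real) ^ k) powr (4 / 5)"
      proof -
        have "(32 :: real) powr (4 / 5) = (2 powr 5) powr (4 / 5)" by simp
        also have "\<dots> = 16" by (simp only: powr_powr) simp
        finally have "(16 :: real) ^ k = (32 powr (4 / 5)) powr real k"
          by (simp add: powr_realpow)
        also have "\<dots> = (32 powr real k) powr (4 / 5)" by (simp only: powr_powr mult.commute)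
        finally show ?thesis by (simp add: powr_realpow)
      qed
      have "16 ^ k / (2400 * real k) \<le> 16 ^ k / (2400 * real k) powr (4 / 5)"
        using k powr_mono[of "4 / 5" 1 "2400 * real k"] by (intro divide_left_mono) auto
      also have "\<dots> = (32 ^ k) powr (4 / 5) / (2400 * real k) powr (4 / 5)"
        by (simp only: p16)
      also have "\<dots> = (32 ^ k / (2400 * real k)) powr (4 / 5)"
        by (simp add: powr_divide)
      also have "\<dots> \<le> x"
        unfolding x_def using elim by (intro powr_mono2) auto
      finally have x: "16 ^ k / (2400 * real k) \<le> x" .
      \<comment> \<open>This turns \<open>k\<close> into a logarithm:
        \<open>exp k \<le> 4 ^ k \<le> 16 ^ k / (2400 * k) \<le> x\<close>.\<close>
      have "exp (real k) = exp 1 ^ k" using exp_of_nat_mult[of k "1 :: real"] by simp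
      also have "\<dots> \<le> 4 ^ k" using exp_le by (intro power_mono) auto
      also have "\<dots> = 16 ^ k / 4 ^ k" by (simp add: power_divide[symmetric])
      also have "\<dots> \<le> 16 ^ k / (2400 * real k)"
        using elim by (intro divide_left_mono) auto
      finally have "exp (real k) \<le> x" using x by linarith
      then have ln_x: "real k \<le> ln x"
        by (metis exp_gt_zero less_le_trans ln_ge_iff)
      have "real (H k) \<le> 372 * real k ^ 2 * 16 ^ k" using elim by simp
      \<comment> \<open>The constant is \<open>372 * 2400\<close>.\<close>
      also have "\<dots> = 892800 * (16 ^ k / (2400 * real k) * real k ^ 3)"
        using elim by (simp add: field_simps power2_eq_square power3_eq_cube)
      also have "\<dots> \<le> 892800 * (x * ln x ^ 3)"
        using x ln_x by (intro mult_left_mono mult_mono power_mono) (auto simp: x_def)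
      also have "\<dots> \<le> 892800 * norm (x * ln x ^ 3)" by simp
      finally show ?case by (simp add: x_def)
    qed
  qed
  then have "(\<lambda>k. real (H k)) \<in> soft_bigo (\<lambda>k. real (R k) powr (4 / 5))"
    unfolding soft_bigo_def by blast
  with \<open>strict_mono N\<close> R_top show ?thesis
    unfolding R_def H_def by blast
qed

end
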